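(* Let $\mathcal A$ be a central indecomposable arrangement (reduced or otherwise) in $X=\mathbb C^n$ with defining equation $f=\prod_{i=1}^dL_i\in\mathbb C[x_1,\dots,x_n]$. Then $\mathrm{Der}_X(-\log_0 f)$ is contained in the left ideal $D_n\cdot(x_1,\dots,x_n)$ of the Weyl algebra $D_n$. If, in addition, $\mathrm{ann}_{D_n}(f^s)$ is generated by derivations, then $b_f(-n/d)=0$.
   Context: The $L_i$ are homogeneous linear forms, not necessarily distinct, and $d\ge1$. A central arrangement is decomposable if, after a linear change of coordinates, the variables can be partitioned into two non-empty sets such that $f$ is a product of a polynomial in the first set and a polynomial in the second set (one factor may be constant, so non-essential arrangements are decomposable); otherwise it is indecomposable. $D_n=\mathbb C[x]\langle\partial_1,\dots,\partial_n\rangle$ is the Weyl algebra. $\mathrm{Der}_X(-\log_0f)$ is the set of vector fields $\delta=\sum a_i\partial_i$, $a_i\in\mathbb C[x]$, with $\delta(f)=0$, viewed inside $D_n$. $D_n[s]$ acts on the free $\mathbb C[x][f^{-1},s]$-module on the symbol $f^s$ by $\delta\bullet(\frac{g}{f^k}f^s)=\delta(\frac{g}{f^k})f^s+\frac{sg}{f^{k+1}}\delta(f)f^s$ for derivations $\delta$; $\mathrm{ann}_{D_n}(f^s)=\{P\in D_n:P\bullet f^s=0\}$, and it is "generated by derivations" if it equals $D_n\cdot\mathrm{Der}_X(-\log_0f)$. $b_f(s)$ is the Bernstein--Sato polynomial: the monic generator of the ideal of all $b(s)\in\mathbb C[s]$ such that $(P\cdot f)\bullet f^s=b(s)f^s$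 for some $P\in D_n[s]$. *)

theory Defs
  imports
    "HOL-Analysis.Determinants"
    "HOL-Library.Poly_Mapping"
    "HOL-Computational_Algebra.Polynomial"
    "HOL-Computational_Algebra.Fraction_Field"
begin

section \<open>Polynomials in the coordinates of affine space\<close>

text \<open>
  The index type \<open>'n\<close> of the coordinates stands for \<open>{1, ..., n}\<close>, so \<open>n = CARD('n)\<close>.
  Where the fraction field occurs, \<open>'n\<close> is linearly ordered, because the library proves that
  polynomials form an integral domain only under this hypothesis; no definition uses the order.
\<close>

type_synonym 'n mpoly = "('n \<Rightarrow>\<^sub>0 nat) \<Rightarrow>\<^sub>0 complex"

definition mconst :: "complex \<Rightarrow> 'n mpoly" where
  "mconst c = Poly_Mapping.single 0 c"

definition mvar :: "'n \<Rightarrow> 'n mpoly" where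
  "mvar i = Poly_Mapping.single (Poly_Mapping.single i 1) 1"

definition mvars :: "'n mpoly \<Rightarrow> 'n set" where
  "mvars p = (\<Union>m\<in>Poly_Mapping.keys p. Poly_Mapping.keys m)"

text \<open>The coefficient of \<open>x^m\<close> in \<open>\<partial>p/\<partial>x_i\<close> is \<open>m_i + 1\<close> times that of \<open>x_i x^m\<close> in \<open>p\<close>.\<close>

lift_definition mderiv :: "'n \<Rightarrow> 'n mpoly \<Rightarrow> 'n mpoly" is
  "\<lambda>i p m. of_nat (Poly_Mapping.lookup m i + 1) * p (m + Poly_Mapping.single i 1)"
proof -
  fix i :: 'n and p :: "('n \<Rightarrow>\<^sub>0 nat) \<Rightarrow> complex"
  assume fin: "finite {m. p m \<noteq> 0}"
  have "finite ((\<lambda>m. m + Poly_Mapping.single i (1::nat)) -` {m. p m \<noteq> 0})"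
    using fin by (rule finite_vimageI) (simp add: inj_def)
  then show "finite {m. of_nat (Poly_Mapping.lookup m i + 1) * p (m + Poly_Mapping.single i 1) \<noteq> 0}"
    by (rule rev_finite_subset) auto
qed

definition msubst :: "('n \<Rightarrow> 'n::finite mpoly) \<Rightarrow> 'n mpoly \<Rightarrow> 'n mpoly" where
  "msubst \<sigma> p = (\<Sum>m\<in>Poly_Mapping.keys p.
     mconst (Poly_Mapping.lookup p m) * (\<Prod>i\<in>UNIV. \<sigma> i ^ Poly_Mapping.lookup m i))"

lemma lookup_mderiv:
  "Poly_Mapping.lookup (mderiv i p) m
    = of_nat (Poly_Mapping.lookup m i + 1) * Poly_Mapping.lookup p (m + Poly_Mapping.single i 1)"
  by transfer simp

lemma mderiv_add: "mderiv i (p + q) = mderiv i p + mderiv i q"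
  by (rule poly_mapping_eqI) (simp add: lookup_mderiv lookup_add algebra_simps)

lemma mderiv_uminus: "mderiv i (- p) = - mderiv i p"
  by (rule poly_mapping_eqI) (simp add: lookup_mderiv)

lemma mderiv_zero [simp]: "mderiv i 0 = 0"
  by (rule poly_mapping_eqI) (simp add: lookup_mderiv)

lemma mderiv_diff: "mderiv i (p - q) = mderiv i p - mderiv i q"
  using mderiv_add[of i p "- q"] by (simp add: mderiv_uminus)

lemma mderiv_commute: "mderiv i (mderiv j p) = mderiv j (mderiv i p)"
  by (rule poly_mapping_eqI)
    (auto simp: lookup_mderiv lookup_add lookup_single when_def add_ac mult_ac)

lemma mderiv_single:
  "mderiv i (Poly_Mapping.single m c)
    = Poly_Mapping.single (m - Poly_Mapping.single i 1) (of_nat (Poly_Mapping.lookup m i) * c)"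
proof (rule poly_mapping_eqI)
  fix k
  have *: "m = k + Poly_Mapping.single i 1 \<longleftrightarrow>
      m - Poly_Mapping.single i 1 = k \<and> Poly_Mapping.lookup m i \<noteq> 0"
  proof
    assume "m = k + Poly_Mapping.single i 1"
    then show "m - Poly_Mapping.single i 1 = k \<and> Poly_Mapping.lookup m i \<noteq> 0"
      by (simp add: lookup_add)
  next
    assume r: "m - Poly_Mapping.single i 1 = k \<and> Poly_Mapping.lookup m i \<noteq> 0"
    show "m = k + Poly_Mapping.single i 1"
    proof (rule poly_mapping_eqI)
      fix j
      show "Poly_Mapping.lookup m j = Poly_Mapping.lookup (k + Poly_Mapping.single i 1) j"
        using r by (auto simp: lookup_add lookup_minus lookup_single when_def)
    qed
  qed
  show "Poly_Mapping.lookup (mderiv i (Poly_Mapping.single m c)) k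
      = Poly_Mapping.lookup (Poly_Mapping.single (m - Poly_Mapping.single i 1)
          (of_nat (Poly_Mapping.lookup m i) * c)) k"
  proof (cases "m = k + Poly_Mapping.single i 1")
    case True
    then have "m - Poly_Mapping.single i 1 = k" "Poly_Mapping.lookup m i = Poly_Mapping.lookup k i + 1"
      using * by (auto simp: lookup_add)
    with True show ?thesis
      unfolding lookup_mderiv lookup_single when_def by (simp del: One_nat_def)
  next
    case False
    with * have "m - Poly_Mapping.single i 1 \<noteq> k \<or> Poly_Mapping.lookup m i = 0"
      by blast
    with False show ?thesis
      unfolding lookup_mderiv lookup_single when_def by (auto simp del: One_nat_def)
  qed
qed

lemma mpoly_sum_singles:
  "p = (\<Sum>m\<in>Poly_Mapping.keys p. Poly_Mapping.single m (Poly_Mapping.lookup p m))"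
  by (rule poly_mapping_eqI)
    (simp add: lookup_sum lookup_single when_def in_keys_iff)

lemma mpoly_induct [case_names zero single add]:
  assumes "P (0 :: 'n mpoly)" "\<And>m c. P (Poly_Mapping.single m c)"
    "\<And>p q. P p \<Longrightarrow> P q \<Longrightarrow> P (p + q)"
  shows "P p"
proof -
  have "P (\<Sum>m\<in>A. Poly_Mapping.single m (Poly_Mapping.lookup p m))" if "finite A" for A
    using that by induction (use assms in auto)
  from this[OF finite_keys[of p]] show ?thesis
    by (subst mpoly_sum_singles)
qed

lemma mderiv_mult: "mderiv i (p * q) = mderiv i p * q + p * mderiv i q"
proof (induction p rule: mpoly_induct)
  case (single m c)
  show ?case
  proof (induction q rule: mpoly_induct)
    case (single k d)
    let ?e = "Poly_Mapping.single i (1::nat)"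
    have a: "(m - ?e) + k = m + k - ?e" if "Poly_Mapping.lookup m i \<noteq> 0"
      using that by (intro poly_mapping_eqI)
        (auto simp: lookup_add lookup_minus lookup_single when_def)
    have b: "m + (k - ?e) = m + k - ?e" if "Poly_Mapping.lookup k i \<noteq> 0"
      using that by (intro poly_mapping_eqI)
        (auto simp: lookup_add lookup_minus lookup_single when_def)
    show ?case
      by (cases "Poly_Mapping.lookup m i = 0"; cases "Poly_Mapping.lookup k i = 0")
        (simp_all only: mderiv_single mult_single lookup_add a b of_nat_add distrib_left
          distrib_right single_add mult.assoc mult.left_commute[of c] of_nat_0 mult_zero_left
          mult_zero_right add_0_left add_0_right single_zero not_False_eq_True)
  qed (simp_all add: mderiv_add algebra_simps)
qed (simp_all add: mderiv_add algebra_simps)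

lemma mderiv_one [simp]: "mderiv i 1 = 0"
  using mderiv_mult[of i 1 1] by simp


section \<open>Central arrangements\<close>

text \<open>A linear form is required to be nonzero, so that it defines a hyperplane.\<close>

definition linear_form :: "'n::finite mpoly \<Rightarrow> bool" where
  "linear_form p \<longleftrightarrow> p \<noteq> 0 \<and> (\<exists>c. p = (\<Sum>i\<in>UNIV. mconst (c i) * mvar i))"

definition linear_change :: "complex^'n^'n \<Rightarrow> 'n::finite mpoly \<Rightarrow> 'n mpoly" where
  "linear_change A = msubst (\<lambda>i. \<Sum>j\<in>UNIV. mconst (A $ i $ j) * mvar j)"

definition decomposable :: "'n::finite mpoly \<Rightarrow> bool" where
  "decomposable f \<longleftrightarrow> (\<exists>(A :: complex^'n^'n) S g h. invertible A \<and> S \<noteq> {} \<and> - S \<noteq> {} \<and>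
     mvars g \<subseteq> S \<and> mvars h \<subseteq> - S \<and> linear_change A f = g * h)"


section \<open>The Weyl algebra\<close>

text \<open>
  The Weyl algebra is the ring generated by \<open>\<complex>[x]\<close> and the \<open>\<partial>_i\<close> subject to
  \<open>\<partial>_i \<partial>_j = \<partial>_j \<partial>_i\<close> and \<open>\<partial>_i p = p \<partial>_i + \<partial>p/\<partial>x_i\<close>: ring expressions modulo the least
  congruence that contains the ring axioms and these relations.
\<close>

datatype 'n weyl_expr =
    WPoly "'n mpoly"
  | WD 'n
  | WAdd "'n weyl_expr" "'n weyl_expr"
  | WNeg "'n weyl_expr"
  | WMul "'n weyl_expr" "'n weyl_expr"

inductive weyl_rel :: "'n weyl_expr \<Rightarrow> 'n weyl_expr \<Rightarrow> bool" where
  refl: "weyl_rel a a"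
| sym: "weyl_rel a b \<Longrightarrow> weyl_rel b a"
| trans: "weyl_rel a b \<Longrightarrow> weyl_rel b c \<Longrightarrow> weyl_rel a c"
| cong_add: "weyl_rel a a' \<Longrightarrow> weyl_rel b b' \<Longrightarrow> weyl_rel (WAdd a b) (WAdd a' b')"
| cong_neg: "weyl_rel a a' \<Longrightarrow> weyl_rel (WNeg a) (WNeg a')"
| cong_mul: "weyl_rel a a' \<Longrightarrow> weyl_rel b b' \<Longrightarrow> weyl_rel (WMul a b) (WMul a' b')"
| add_assoc: "weyl_rel (WAdd (WAdd a b) c) (WAdd a (WAdd b c))"
| add_commute: "weyl_rel (WAdd a b) (WAdd b a)"
| add_0: "weyl_rel (WAdd (WPoly 0) a) a"
| add_neg: "weyl_rel (WAdd (WNeg a) a) (WPoly 0)"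
| mul_assoc: "weyl_rel (WMul (WMul a b) c) (WMul a (WMul b c))"
| mul_1_left: "weyl_rel (WMul (WPoly 1) a) a"
| mul_1_right: "weyl_rel (WMul a (WPoly 1)) a"
| distrib_left: "weyl_rel (WMul a (WAdd b c)) (WAdd (WMul a b) (WMul a c))"
| distrib_right: "weyl_rel (WMul (WAdd a b) c) (WAdd (WMul a c) (WMul b c))"
| poly_add: "weyl_rel (WAdd (WPoly p) (WPoly q)) (WPoly (p + q))"
| poly_mult: "weyl_rel (WMul (WPoly p) (WPoly q)) (WPoly (p * q))"
| D_commute: "weyl_rel (WMul (WD i) (WD j)) (WMul (WD j) (WD i))"
| D_poly: "weyl_rel (WMul (WD i) (WPoly p)) (WAdd (WMul (WPoly p) (WD i)) (WPoly (mderiv i p)))"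

quotient_type 'n weyl = "'n weyl_expr" / weyl_rel
  by (rule equivpI) (blast intro: reflpI sympI transpI weyl_rel.intros)+

lift_definition weyl_poly :: "'n mpoly \<Rightarrow> 'n weyl" is WPoly .

lift_definition weyl_D :: "'n \<Rightarrow> 'n weyl" is WD .

text \<open>The action of an expression on a module, given the actions of the generators.\<close>

primrec weyl_eval ::
  "('n mpoly \<Rightarrow> 'm \<Rightarrow> 'm) \<Rightarrow> ('n \<Rightarrow> 'm \<Rightarrow> 'm) \<Rightarrow> 'n weyl_expr \<Rightarrow> 'm \<Rightarrow> 'm::ab_group_add" where
  "weyl_eval sc de (WPoly p) = sc p"
| "weyl_eval sc de (WD i) = de i"
| "weyl_eval sc de (WAdd a b) = (\<lambda>m. weyl_eval sc de a m + weyl_eval sc de b m)"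
| "weyl_eval sc de (WNeg a) = (\<lambda>m. - weyl_eval sc de a m)"
| "weyl_eval sc de (WMul a b) = (\<lambda>m. weyl_eval sc de a (weyl_eval sc de b m))"

lemma weyl_eval_add:
  fixes sc :: "'n mpoly \<Rightarrow> 'm \<Rightarrow> 'm::ab_group_add"
  assumes "\<And>p m m'. sc p (m + m') = sc p m + sc p m'"
    and "\<And>i m m'. de i (m + m') = de i m + de i m'"
  shows "weyl_eval sc de a (m + m') = weyl_eval sc de a m + weyl_eval sc de a m'"
  by (induction a arbitrary: m m') (simp_all add: assms algebra_simps)

lemma weyl_eval_rel:
  fixes sc :: "'n mpoly \<Rightarrow> 'm \<Rightarrow> 'm::ab_group_add"
  assumes sc_add: "\<And>p m m'. sc p (m + m') = sc p m + sc p m'"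
    and de_add: "\<And>i m m'. de i (m + m') = de i m + de i m'"
    and sc_plus: "\<And>p q m. sc (p + q) m = sc p m + sc q m"
    and sc_mult: "\<And>p q m. sc (p * q) m = sc p (sc q m)"
    and sc_one: "\<And>m. sc 1 m = m"
    and de_comm: "\<And>i j m. de i (de j m) = de j (de i m)"
    and leibniz: "\<And>i p m. de i (sc p m) = sc p (de i m) + sc (mderiv i p) m"
    and "weyl_rel a b"
  shows "weyl_eval sc de a = weyl_eval sc de b"
proof -
  have sc_zero: "sc 0 m = 0" for m
    using sc_plus[of 0 0 m] by simp
  from \<open>weyl_rel a b\<close> show ?thesis
    by induction
      (auto simp: sc_zero sc_plus sc_mult sc_one leibniz de_comm add_ac
        weyl_eval_add[of sc de, OF sc_add de_add])
qed

instantiation weyl :: (type) ring_1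
begin

lift_definition zero_weyl :: "'a weyl" is "WPoly 0" .
lift_definition one_weyl :: "'a weyl" is "WPoly 1" .
lift_definition plus_weyl :: "'a weyl \<Rightarrow> 'a weyl \<Rightarrow> 'a weyl" is WAdd by (rule weyl_rel.cong_add)
lift_definition uminus_weyl :: "'a weyl \<Rightarrow> 'a weyl" is WNeg by (rule weyl_rel.cong_neg)
lift_definition minus_weyl :: "'a weyl \<Rightarrow> 'a weyl \<Rightarrow> 'a weyl" is "\<lambda>a b. WAdd a (WNeg b)"
  by (intro weyl_rel.cong_add weyl_rel.cong_neg weyl_rel.refl)
lift_definition times_weyl :: "'a weyl \<Rightarrow> 'a weyl \<Rightarrow> 'a weyl" is WMul by (rule weyl_rel.cong_mul)

instance
proof
  have "\<not> weyl_rel (WPoly 0 :: 'a weyl_expr) (WPoly 1)"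
  proof
    assume r: "weyl_rel (WPoly 0 :: 'a weyl_expr) (WPoly 1)"
    have "weyl_eval (*) mderiv (WPoly 0 :: 'a weyl_expr) = weyl_eval (*) mderiv (WPoly 1)"
      by (rule weyl_eval_rel[OF _ _ _ _ _ _ _ r])
        (auto simp: mderiv_add mderiv_mult mderiv_commute algebra_simps)
    from fun_cong[OF this, of 1] show False
      by simp
  qed
  then show "(0::'a weyl) \<noteq> 1"
    by transfer
next
  fix a b c :: "'a weyl"
  show "a + b + c = a + (b + c)" by transfer (rule weyl_rel.add_assoc)
  show "a + b = b + a" by transfer (rule weyl_rel.add_commute)
  show "0 + a = a" by transfer (rule weyl_rel.add_0)
  show "- a + a = 0" by transfer (rule weyl_rel.add_neg)
  show "a - b = a + - b" by transfer (rule weyl_rel.refl)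
  show "a * b * c = a * (b * c)" by transfer (rule weyl_rel.mul_assoc)
  show "1 * a = a" by transfer (rule weyl_rel.mul_1_left)
  show "a * 1 = a" by transfer (rule weyl_rel.mul_1_right)
  show "a * (b + c) = a * b + a * c" by transfer (rule weyl_rel.distrib_left)
  show "(a + b) * c = a * c + b * c" by transfer (rule weyl_rel.distrib_right)
qed

end

type_synonym 'n vfield = "'n \<Rightarrow> 'n mpoly"

definition vf_apply :: "'n::finite vfield \<Rightarrow> 'n mpoly \<Rightarrow> 'n mpoly" where
  "vf_apply a p = (\<Sum>i\<in>UNIV. a i * mderiv i p)"

definition vf_weyl :: "'n::finite vfield \<Rightarrow> 'n weyl" where
  "vf_weyl a = (\<Sum>i\<in>UNIV. weyl_poly (a i) * weyl_D i)"

definition Der_log0 :: "'n::finite mpoly \<Rightarrow> 'n weyl set" where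
  "Der_log0 f = {vf_weyl a | a. vf_apply a f = 0}"

definition left_ideal :: "'a::ring_1 set \<Rightarrow> 'a set" where
  "left_ideal S = {\<Sum>x\<in>T. c x * x | T c. finite T \<and> T \<subseteq> S}"


section \<open>The action on \<open>f^s\<close>\<close>

lemma quotient_rule_cong:
  fixes a b c d a' b' c' d' :: "'a::idom"
  assumes e: "a * d = c * b" and e': "a' * d + a * d' = c' * b + c * b'"
  shows "(a' * b - a * b') * (d * d) = (c' * d - c * d') * (b * b)"
proof -
  have "(a' * b - a * b') * (d * d) = b * d * (a' * d) - b' * d * (a * d)"
    by (simp add: algebra_simps)
  also have "a' * d = c' * b + c * b' - a * d'"
    using e' by (simp add: algebra_simps)
  also have "b * d * (c' * b + c * b' - a * d') - b' * d * (a * d)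
      = b * d * (c' * b + c * b') - b * d' * (a * d) - b' * d * (a * d)"
    by (simp add: algebra_simps)
  also have "\<dots> = (c' * d - c * d') * (b * b)"
    unfolding e by (simp add: algebra_simps)
  finally show ?thesis .
qed

text \<open>The derivation of the fraction field extending \<open>mderiv i\<close>, by the quotient rule.\<close>

lift_definition fderiv :: "'n \<Rightarrow> 'n::{finite,linorder} mpoly fract \<Rightarrow> 'n mpoly fract" is
  "\<lambda>i x. (mderiv i (fst x) * snd x - fst x * mderiv i (snd x), snd x * snd x)"
  subgoal premises p for i x y
  proof -
    have nz: "snd x \<noteq> 0" "snd y \<noteq> 0" and e: "fst x * snd y = fst y * snd x"
      using p unfolding fractrel_iff by blast+
    have e': "mderiv i (fst x) * snd y + fst x * mderiv i (snd y)
        = mderiv i (fst y) * snd x + fst y * mderiv i (snd x)"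
      using arg_cong[OF e, of "mderiv i"] unfolding mderiv_mult .
    show ?thesis
      unfolding fractrel_iff fst_conv snd_conv
      by (intro conjI no_zero_divisors nz quotient_rule_cong e e')
  qed
  done

lemma fderiv_Fract:
  assumes "b \<noteq> 0"
  shows "fderiv i (Fract a b) = Fract (mderiv i a * b - a * mderiv i b) (b * b)"
proof -
  have abs: "Fract c d = abs_fract (c, d)" if "d \<noteq> 0" for c d :: "'a mpoly"
    using that by (simp add: Fract_def)
  have "fractrel (a, b) (a, b)"
    using assms by (simp add: fractrel_iff)
  then show ?thesis
    unfolding abs[OF assms] abs[OF no_zero_divisors[OF assms assms]]
    by (simp only: fderiv.abs_eq fst_conv snd_conv)
qed

text \<open>
  An element \<open>m\<close> of the following type stands for \<open>m f^s\<close>, a polynomial in \<open>s\<close> with coefficients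
  in \<open>\<complex>(x)\<close>; in particular \<open>1\<close> stands for \<open>f^s\<close>. The free \<open>\<complex>[x][f^{-1},s]\<close>-module on \<open>f^s\<close> is the
  subset \<open>fs_module f\<close>, which the action preserves (\<open>weyl_act_fs_module\<close>, \<open>weyls_act_fs_module\<close>).
\<close>

type_synonym 'n smod = "'n mpoly fract poly"

definition localization :: "'n::{finite,linorder} mpoly \<Rightarrow> 'n mpoly fract set" where
  "localization f = {Fract g (f ^ k) | g k. True}"

definition fs_module :: "'n::{finite,linorder} mpoly \<Rightarrow> 'n smod set" where
  "fs_module f = {m. \<forall>j. coeff m j \<in> localization f}"

definition fs_scale :: "'n::{finite,linorder} mpoly \<Rightarrow> 'n smod \<Rightarrow> 'n smod" where
  "fs_scale p m = smult (Fract p 1) m"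

text \<open>\<open>\<partial>_i (m f^s) = \<partial>_i(m) f^s + s m (\<partial>_i(f) / f) f^s\<close>\<close>

definition fs_D :: "'n::{finite,linorder} mpoly \<Rightarrow> 'n \<Rightarrow> 'n smod \<Rightarrow> 'n smod" where
  "fs_D f i m = map_poly (fderiv i) m + [:0, 1:] * smult (Fract (mderiv i f) f) m"

lemma fderiv_0 [simp]: "fderiv i 0 = 0"
  by (simp add: Zero_fract_def fderiv_Fract)

lemma fderiv_add: "fderiv i (x + y) = fderiv i x + fderiv i y"
  by (cases x; cases y)
    (simp add: fderiv_Fract eq_fract mderiv_add mderiv_mult algebra_simps)

lemma fderiv_mult: "fderiv i (x * y) = fderiv i x * y + x * fderiv i y"
  by (cases x; cases y)
    (simp add: fderiv_Fract eq_fract mderiv_add mderiv_mult algebra_simps)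

lemma fderiv_poly: "fderiv i (Fract p 1) = Fract (mderiv i p) 1"
  by (simp add: fderiv_Fract)

lemma fderiv_commute: "fderiv i (fderiv j x) = fderiv j (fderiv i x)"
proof (cases x)
  case (Fract a b)
  have xb: "x * Fract b 1 = Fract a 1"
    using Fract by (simp add: eq_fract)
  have "fderiv i (fderiv j (x * Fract b 1)) = fderiv j (fderiv i (x * Fract b 1))"
    unfolding xb fderiv_poly by (simp only: mderiv_commute[of i j])
  then have "fderiv i (fderiv j x) * Fract b 1 = fderiv j (fderiv i x) * Fract b 1"
    unfolding fderiv_mult fderiv_add fderiv_poly mderiv_commute[of i j]
    by (simp only: algebra_simps add_left_cancel)
  moreover have "Fract b 1 \<noteq> 0"
    using Fract by (simp add: Zero_fract_def eq_fract)
  ultimately show ?thesis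
    by (simp only: mult_cancel_right simp_thms)
qed

lemma coeff_fs_scale: "coeff (fs_scale p m) j = Fract p 1 * coeff m j"
  by (simp add: fs_scale_def)

lemma coeff_fs_D:
  "coeff (fs_D f i m) j = fderiv i (coeff m j)
    + (case j of 0 \<Rightarrow> 0 | Suc k \<Rightarrow> Fract (mderiv i f) f * coeff m k)"
  by (auto simp: fs_D_def coeff_map_poly coeff_pCons split: nat.splits)

lemma dlog_commute:
  fixes f :: "'n::{finite,linorder} mpoly"
  shows "fderiv i (Fract (mderiv j f) f) = fderiv j (Fract (mderiv i f) f)"
proof (cases "f = 0")
  case True
  then show ?thesis
    by (simp add: eq_fract flip: Zero_fract_def)
next
  case False
  then show ?thesis
    by (simp only: fderiv_Fract[OF False] mderiv_commute[of i j] mult.commute[of "mderiv j f"])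
qed

lemma fs_scale_add: "fs_scale p (m + m') = fs_scale p m + fs_scale p m'"
  by (simp add: fs_scale_def smult_add_right)

lemma fs_scale_plus: "fs_scale (p + q) m = fs_scale p m + fs_scale q m"
  by (simp add: fs_scale_def flip: smult_add_left)

lemma fs_scale_mult: "fs_scale (p * q) m = fs_scale p (fs_scale q m)"
  by (simp add: fs_scale_def)

lemma fs_scale_one: "fs_scale 1 m = m"
  by (simp add: fs_scale_def flip: One_fract_def)

lemma fs_D_add: "fs_D f i (m + m') = fs_D f i m + fs_D f i m'"
  by (rule poly_eqI) (simp add: coeff_fs_D fderiv_add algebra_simps split: nat.splits)

lemma fs_D_commute: "fs_D f i (fs_D f j m) = fs_D f j (fs_D f i m)"
  by (rule poly_eqI)
    (auto simp: coeff_fs_D fderiv_add fderiv_mult fderiv_commute[of i j] dlog_commute[of i j]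
      algebra_simps split: nat.splits)

lemma fs_D_scale: "fs_D f i (fs_scale p m) = fs_scale p (fs_D f i m) + fs_scale (mderiv i p) m"
  by (rule poly_eqI)
    (auto simp: coeff_fs_D coeff_fs_scale fderiv_mult fderiv_poly algebra_simps split: nat.splits)

lift_definition weyl_act :: "'n::{finite,linorder} mpoly \<Rightarrow> 'n weyl \<Rightarrow> 'n smod \<Rightarrow> 'n smod" is
  "\<lambda>f. weyl_eval fs_scale (fs_D f)"
  by (rule weyl_eval_rel)
    (assumption | rule fs_scale_add fs_D_add fs_scale_plus fs_scale_mult fs_scale_one
      fs_D_commute fs_D_scale)+

lemma weyl_act_simps [simp]:
  "weyl_act f (weyl_poly p) m = fs_scale p m"
  "weyl_act f (weyl_D i) m = fs_D f i m"
  "weyl_act f (P + Q) m = weyl_act f P m + weyl_act f Q m"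
  "weyl_act f (- P) m = - weyl_act f P m"
  "weyl_act f (P * Q) m = weyl_act f P (weyl_act f Q m)"
  "weyl_act f 0 m = 0"
  "weyl_act f 1 m = m"
proof -
  have P: "weyl_act f (weyl_poly p) = fs_scale p" for p
    by (simp add: weyl_poly_def weyl_act.abs_eq)
  show "weyl_act f (weyl_poly p) m = fs_scale p m"
    by (simp only: P)
  show "weyl_act f (weyl_D i) m = fs_D f i m"
    by (simp add: weyl_D_def weyl_act.abs_eq)
  show "weyl_act f (P + Q) m = weyl_act f P m + weyl_act f Q m"
    by (induction P rule: weyl.abs_induct; induction Q rule: weyl.abs_induct)
      (simp add: plus_weyl.abs_eq weyl_act.abs_eq)
  show "weyl_act f (- P) m = - weyl_act f P m"
    by (induction P rule: weyl.abs_induct) (simp add: uminus_weyl.abs_eq weyl_act.abs_eq)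
  show "weyl_act f (P * Q) m = weyl_act f P (weyl_act f Q m)"
    by (induction P rule: weyl.abs_induct; induction Q rule: weyl.abs_induct)
      (simp add: times_weyl.abs_eq weyl_act.abs_eq)
  show "weyl_act f 0 m = 0"
    by (simp add: zero_weyl_def weyl_act.abs_eq fs_scale_def flip: Zero_fract_def)
  show "weyl_act f 1 m = m"
    by (simp add: one_weyl_def weyl_act.abs_eq fs_scale_one)
qed

lemma localization_closed:
  fixes f :: "'n::{finite,linorder} mpoly"
  assumes f: "f \<noteq> 0"
  shows "0 \<in> localization f" "Fract p 1 \<in> localization f" "Fract p f \<in> localization f"
    and "x \<in> localization f \<Longrightarrow> y \<in> localization f \<Longrightarrow> x + y \<in> localization f"
    and "x \<in> localization f \<Longrightarrow> - x \<in> localization f"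
    and "x \<in> localization f \<Longrightarrow> y \<in> localization f \<Longrightarrow> x * y \<in> localization f"
    and "x \<in> localization f \<Longrightarrow> fderiv i x \<in> localization f"
proof -
  have R: "Fract g (f ^ k) \<in> localization f" for g k
    unfolding localization_def by blast
  have nz: "f ^ k \<noteq> 0" for k
    using f by (rule power_not_zero)
  show one: "Fract p 1 \<in> localization f" for p
    using R[of p 0] by (simp only: power_0)
  show "0 \<in> localization f"
    unfolding Zero_fract_def by (rule one)
  show "Fract p f \<in> localization f"
    using R[of p 1] by (simp only: power_one_right)
  show "x + y \<in> localization f" if xy: "x \<in> localization f" "y \<in> localization f"
  proof -
    obtain g k h l where "x = Fract g (f ^ k)" "y = Fract h (f ^ l)"
      using xy unfolding localization_def by blast
    then show ?thesis
      using R[of _ "k + l"] by (simp only: add_fract[OF nz nz] power_add)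
  qed
  show "- x \<in> localization f" if x: "x \<in> localization f"
  proof -
    obtain g k where "x = Fract g (f ^ k)"
      using x unfolding localization_def by blast
    then show ?thesis
      using R by (simp only: minus_fract)
  qed
  show "x * y \<in> localization f" if xy: "x \<in> localization f" "y \<in> localization f"
  proof -
    obtain g k h l where "x = Fract g (f ^ k)" "y = Fract h (f ^ l)"
      using xy unfolding localization_def by blast
    then show ?thesis
      using R[of _ "k + l"] by (simp only: mult_fract power_add)
  qed
  show "fderiv i x \<in> localization f" if x: "x \<in> localization f"
  proof -
    obtain g k where "x = Fract g (f ^ k)"
      using x unfolding localization_def by blast
    then show ?thesis
      using R[of _ "k + k"] by (simp only: fderiv_Fract[OF nz] power_add)
  qed
qed

lemma fs_module_add:
  "f \<noteq> 0 \<Longrightarrow> m \<in> fs_module f \<Longrightarrow> m' \<in> fs_module f \<Longrightarrow> m + m' \<in> fs_module f"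
  by (simp add: fs_module_def localization_closed)

lemma weyl_act_fs_module:
  assumes f: "f \<noteq> 0" and m: "m \<in> fs_module f"
  shows "weyl_act f P m \<in> fs_module f"
proof -
  have D: "fs_D f i m \<in> fs_module f" if "m \<in> fs_module f" for i m
    using that
    by (auto simp: fs_module_def coeff_fs_D intro!: localization_closed[OF f] split: nat.split)
  have S: "fs_scale p m \<in> fs_module f" if "m \<in> fs_module f" for p m
    using that by (simp add: fs_module_def coeff_fs_scale localization_closed[OF f])
  have N: "- m \<in> fs_module f" if "m \<in> fs_module f" for m
    using that by (simp add: fs_module_def localization_closed[OF f])
  have "weyl_eval fs_scale (fs_D f) e m \<in> fs_module f" for e
    using m by (induction e arbitrary: m) (simp_all add: D S N fs_module_add[OF f])
  then show ?thesis
    by (induction P rule: weyl.abs_induct) (simp add: weyl_act.abs_eq)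
qed

definition ann_fs :: "'n::{finite,linorder} mpoly \<Rightarrow> 'n weyl set" where
  "ann_fs f = {P. weyl_act f P 1 = 0}"

text \<open>
  \<open>D_n[s]\<close> is the ring of polynomials in a central variable \<open>s\<close> over the Weyl algebra; the product
  on \<open>\<Rightarrow>\<^sub>0\<close> is the convolution product. The type \<open>poly\<close> has no product over a noncommutative ring.
\<close>

type_synonym 'n weyls = "nat \<Rightarrow>\<^sub>0 'n weyl"

definition weyls_act :: "'n::{finite,linorder} mpoly \<Rightarrow> 'n weyls \<Rightarrow> 'n smod \<Rightarrow> 'n smod" where
  "weyls_act f P m =
    (\<Sum>j\<in>Poly_Mapping.keys P. [:0, 1:] ^ j * weyl_act f (Poly_Mapping.lookup P j) m)"

lemma weyls_act_fs_module:
  assumes f: "f \<noteq> 0" and m: "m \<in> fs_module f"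
  shows "weyls_act f P m \<in> fs_module f"
proof -
  have z: "0 \<in> fs_module f"
    by (simp add: fs_module_def localization_closed[OF f])
  have s: "[:0, 1:] * m \<in> fs_module f" if "m \<in> fs_module f" for m
    using that by (auto simp: fs_module_def coeff_pCons localization_closed[OF f] split: nat.split)
  have p: "[:0, 1:] ^ j * m \<in> fs_module f" if "m \<in> fs_module f" for j m
    using that by (induction j) (simp_all only: power_0 mult_1_left power_Suc mult.assoc s)
  have "(\<Sum>j\<in>J. [:0, 1:] ^ j * weyl_act f (Poly_Mapping.lookup P j) m) \<in> fs_module f"
    if "finite J" for J
    using that
    by induction (simp_all only: sum.empty sum.insert z p fs_module_add[OF f] weyl_act_fs_module[OF f m] simp_thms)
  then show ?thesis
    unfolding weyls_act_def by simp
qed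

definition smod_of_poly :: "complex poly \<Rightarrow> 'n::{finite,linorder} smod" where
  "smod_of_poly b = map_poly (\<lambda>c. Fract (mconst c) 1) b"

definition bernstein_ideal :: "'n::{finite,linorder} mpoly \<Rightarrow> complex poly set" where
  "bernstein_ideal f =
    {b. \<exists>P. weyls_act f (P * Poly_Mapping.single 0 (weyl_poly f)) 1 = smod_of_poly b}"

text \<open>
  A predicate, as the existence of \<open>b_f\<close> is Bernstein's theorem; uniqueness is clear, since a monic
  generator of an ideal of \<open>\<complex>[s]\<close> is unique.
\<close>

definition is_bernstein_sato :: "'n::{finite,linorder} mpoly \<Rightarrow> complex poly \<Rightarrow> bool" where
  "is_bernstein_sato f b \<longleftrightarrow> lead_coeff b = 1 \<and> bernstein_ideal f = {b * q | q. True}"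

end

theory Submission
  imports Defs
begin

text \<open>
  Let \<open>\<delta> = \<Sum>i a_i \<partial>_i\<close> annihilate \<open>f = \<Prod>i L_i\<close>. Since \<open>f\<close> is homogeneous, the constant part and the
  linear part of \<open>\<delta>\<close> annihilate \<open>f\<close> as well (\<open>vf_apply_hom_component_eq_0\<close>). A derivation that
  annihilates a product of linear forms maps each factor \<open>L_i\<close> to a multiple of itself
  (\<open>vf_apply_vanishes_on_hyperplane\<close>). For a constant field this means by degree that it annihilates
  all \<open>L_i\<close>, so it is zero, for otherwise \<open>f\<close> would not depend on one of the variables in suitable
  coordinates. For a linear field it means that all \<open>L_i\<close> are eigenvectors of one endomorphism of the
  dual space; two different eigenvalues would split the variables, so for indecomposable \<open>f\<close> the field
  is \<open>\<mu> \<Sum>i x_i \<partial>_i\<close> (\<open>indecomposable_imp_scalar\<close>), and \<open>0 = \<delta>(f) = \<mu> d f\<close> gives \<open>\<mu> = 0\<close>. Thus the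
  \<open>a_i\<close> and the divergence of \<open>\<delta>\<close> vanish at the origin (\<open>log_derivation_vanishes\<close>), and moving the
  derivatives to the left writes \<open>\<delta>\<close> as \<open>\<Sum>i \<partial>_i a_i\<close> minus the divergence, an element of
  \<open>D_n (x_1, ..., x_n)\<close>.

  For the root, let \<open>E\<close> be the Euler field. As \<open>E\<close> acts on \<open>f^s\<close> as \<open>d s\<close> and on \<open>f f^s\<close> as \<open>d (s + 1)\<close>, a
  functional equation \<open>(P f) f^s = b(s) f^s\<close> with \<open>P \<in> D_n[s]\<close> can be rewritten without \<open>s\<close>: there is
  \<open>Q \<in> D_n\<close> such that \<open>Q f - b(E/d)\<close> annihilates \<open>f^s\<close>. If the annihilator is generated by derivations, it
  is contained in \<open>D_n (x_1, ..., x_n)\<close>, and so is \<open>Q f\<close>, hence also \<open>b(E/d)\<close>. But \<open>E\<close> is \<open>- n\<close> modulo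
  this left ideal, so the ideal contains the constant \<open>b(- n/d)\<close> (\<open>bernstein_ideal_root\<close>). It is a
  proper ideal, as one sees from the adjoint action on polynomials
  (\<open>weyl_poly_mconst_in_var_ideal\<close>), so \<open>b(- n/d) = 0\<close>.
\<close>

section \<open>Constants and derivatives of polynomials\<close>

lemma mconst_0 [simp]: "mconst 0 = 0"
  and mconst_1 [simp]: "mconst 1 = 1"
  and mconst_add: "mconst (a + b) = mconst a + mconst b"
  and mconst_mult: "mconst (a * b) = mconst a * mconst b"
  by (simp_all add: mconst_def mult_single flip: single_add)

lemma of_nat_mconst: "of_nat k = mconst (of_nat k)"
  by (induction k) (simp_all add: mconst_add)

lemma mconst_uminus: "mconst (- c) = - mconst c"
  by (simp add: mconst_def single_uminus)

lemma mconst_sum: "mconst (sum g A) = (\<Sum>i\<in>A. mconst (g i))"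
  by (induction A rule: infinite_finite_induct) (simp_all add: mconst_add)

lemma mconst_prod: "mconst (prod g A) = (\<Prod>i\<in>A. mconst (g i))"
  by (induction A rule: infinite_finite_induct) (simp_all add: mconst_mult)

lemma mconst_eq_0_iff: "mconst c = 0 \<longleftrightarrow> c = 0"
  by (metis lookup_single_eq lookup_zero mconst_0 mconst_def)

lemma mderiv_mconst [simp]: "mderiv i (mconst c) = 0"
  by (simp add: mconst_def mderiv_single)

lemma mderiv_sum: "mderiv i (sum g A) = (\<Sum>j\<in>A. mderiv i (g j))"
  by (induction A rule: infinite_finite_induct) (simp_all add: mderiv_add)

lemma mderiv_mvar: "mderiv i (mvar j) = (if i = j then 1 else 0)"
  by (auto simp: mvar_def mderiv_single lookup_single when_def)


section \<open>Substitution is a ring homomorphism\<close>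

lemma msubst_superset:
  assumes "finite K" "Poly_Mapping.keys p \<subseteq> K"
  shows "msubst \<sigma> p =
    (\<Sum>m\<in>K. mconst (Poly_Mapping.lookup p m) * (\<Prod>i\<in>UNIV. \<sigma> i ^ Poly_Mapping.lookup m i))"
  unfolding msubst_def using assms
  by (intro sum.mono_neutral_left) (auto simp: in_keys_iff)

lemma msubst_zero [simp]: "msubst \<sigma> 0 = 0"
  by (simp add: msubst_def)

lemma msubst_add: "msubst \<sigma> (p + q) = msubst \<sigma> p + msubst \<sigma> q"
proof -
  let ?K = "Poly_Mapping.keys p \<union> Poly_Mapping.keys q"
  have "Poly_Mapping.keys (p + q) \<subseteq> ?K"
    by (rule keys_add)
  then show ?thesis
    by (simp add: msubst_superset[of ?K] lookup_add mconst_add algebra_simps sum.distrib)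
qed

lemma msubst_single:
  "msubst \<sigma> (Poly_Mapping.single m c) = mconst c * (\<Prod>i\<in>UNIV. \<sigma> i ^ Poly_Mapping.lookup m i)"
  by (subst msubst_superset[of "{m}"]) auto

lemma msubst_mult: "msubst \<sigma> (p * q) = msubst \<sigma> p * msubst \<sigma> q"
proof (induction p rule: mpoly_induct)
  case (single m c)
  show ?case
    by (induction q rule: mpoly_induct)
      (simp_all add: msubst_add mult_single msubst_single mconst_mult lookup_add power_add
        prod.distrib algebra_simps)
qed (simp_all add: msubst_add algebra_simps)

lemma msubst_mconst [simp]: "msubst \<sigma> (mconst c) = mconst c"
  by (simp add: mconst_def msubst_single)

lemma msubst_one [simp]: "msubst \<sigma> 1 = 1"
  using msubst_mconst[of \<sigma> 1] by simp

lemma msubst_mvar: "msubst \<sigma> (mvar i) = \<sigma> i"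
proof -
  have "(\<Prod>j\<in>UNIV. \<sigma> j ^ Poly_Mapping.lookup (Poly_Mapping.single i (1::nat)) j) = (\<Prod>j\<in>UNIV. if j = i then \<sigma> i else 1)"
    by (intro prod.cong) (auto simp: lookup_single when_def)
  then show ?thesis
    by (simp add: mvar_def msubst_single)
qed

lemma msubst_sum: "msubst \<sigma> (sum g A) = (\<Sum>i\<in>A. msubst \<sigma> (g i))"
  by (induction A rule: infinite_finite_induct) (simp_all add: msubst_add)

lemma msubst_prod: "msubst \<sigma> (prod g A) = (\<Prod>i\<in>A. msubst \<sigma> (g i))"
  by (induction A rule: infinite_finite_induct) (simp_all add: msubst_mult)


section \<open>Linear forms\<close>

definition lform :: "complex^'n \<Rightarrow> 'n::finite mpoly" where
  "lform l = (\<Sum>i\<in>UNIV. mconst (l $ i) * mvar i)"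

lemma lookup_lform: "Poly_Mapping.lookup (lform l) (Poly_Mapping.single i 1) = l $ i"
proof -
  have "Poly_Mapping.lookup (lform l) (Poly_Mapping.single i 1) = (\<Sum>j\<in>UNIV. if j = i then l $ i else 0)"
    unfolding lform_def lookup_sum
  proof (rule sum.cong[OF HOL.refl])
    fix j
    have "Poly_Mapping.single j (1::nat) = Poly_Mapping.single i 1 \<longleftrightarrow> j = i"
      by (metis lookup_single_eq lookup_single_not_eq one_neq_zero)
    then show "Poly_Mapping.lookup (mconst (l $ j) * mvar j) (Poly_Mapping.single i 1) = (if j = i then l $ i else 0)"
      by (auto simp: mconst_def mvar_def mult_single lookup_single when_def)
  qed
  then show ?thesis by simp
qed

lemma lform_add: "lform (u + v) = lform u + lform v"
  by (simp add: lform_def mconst_add algebra_simps sum.distrib)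

lemma lform_scale: "lform (c *s v) = mconst c * lform v"
  by (simp add: lform_def mconst_mult algebra_simps sum_distrib_left)

lemma lform_0 [simp]: "lform 0 = 0"
  by (simp add: lform_def)

lemma lform_sum: "lform (sum g A) = (\<Sum>i\<in>A. lform (g i))"
  by (induction A rule: infinite_finite_induct) (simp_all add: lform_add)

lemma lform_eq_0_iff: "lform l = 0 \<longleftrightarrow> l = 0"
  by (metis lform_0 lookup_lform lookup_zero vec_eq_iff zero_index)

lemma linear_form_eq_lform:
  assumes "linear_form p"
  obtains l where "p = lform l" "l \<noteq> 0"
proof -
  obtain c where "p \<noteq> 0" "p = (\<Sum>i\<in>UNIV. mconst (c i) * mvar i)"
    using assms unfolding linear_form_def by blast
  then have "p = lform (vec_lambda c)" "vec_lambda c \<noteq> 0"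
    by (auto simp: lform_def zero_vec_def vec_lambda_inject dest: fun_cong)
  then show ?thesis by (rule that)
qed

lemma vector_matrix_mult_rows: "l v* M = (\<Sum>i\<in>UNIV. (l $ i) *s (M $ i))"
  for M :: "complex^'m^'n"
  by (simp add: vec_eq_iff vector_matrix_mult_def mult.commute)

lemma linear_change_lform: "linear_change A (lform l) = lform (l v* A)"
proof -
  have "linear_change A (lform l) = (\<Sum>i\<in>UNIV. mconst (l $ i) * lform (A $ i))"
    unfolding lform_def[of l] linear_change_def msubst_sum msubst_mult msubst_mconst msubst_mvar
    by (simp add: lform_def)
  then show ?thesis
    by (simp add: vector_matrix_mult_rows lform_sum lform_scale)
qed

lemma linear_change_simps:
  "linear_change A 0 = 0" "linear_change A 1 = 1" "linear_change A (mconst c) = mconst c"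
  "linear_change A (p + q) = linear_change A p + linear_change A q"
  "linear_change A (p * q) = linear_change A p * linear_change A q"
  "linear_change A (prod g I) = (\<Prod>i\<in>I. linear_change A (g i))"
  by (simp_all add: linear_change_def msubst_add msubst_mult msubst_prod)

text \<open>
  The quotient of \<open>\<complex>[x]\<close> by a linear form \<open>l\<close> is realised by solving \<open>l = 0\<close> for a variable
  \<open>x_k\<close> that occurs in \<open>l\<close> and substituting. On linear forms this substitution is the matrix \<open>N\<close>,
  and since the target is again a polynomial ring, it turns divisibility by \<open>l\<close> into vanishing
  in an integral domain.
\<close>

lemma exists_matrix_kernel_line:
  fixes l :: "complex^'n"
  assumes "l \<noteq> 0"
  obtains N :: "complex^'n^'n" where "\<forall>v. v v* N = 0 \<longleftrightarrow> (\<exists>c. v = c *s l)"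
proof -
  obtain k where k: "l $ k \<noteq> 0"
    using assms by (auto simp: vec_eq_iff)
  \<comment> \<open>The substitution \<open>x_k \<mapsto> x_k - l / l_k\<close>, where \<open>l_k\<close> is the coefficient of \<open>x_k\<close>, with the other variables fixed.\<close>
  define N where "N = (\<chi> i. axis i 1 - (if i = k then (1 / l $ k) *s l else 0))"
  have N: "v v* N = v - (v $ k / l $ k) *s l" for v
  proof -
    have "v v* N = (\<Sum>i\<in>UNIV. (v $ i) *s axis i 1) - (\<Sum>i\<in>UNIV. if i = k then (v $ k / l $ k) *s l else 0)"
      unfolding vector_matrix_mult_rows N_def sum_subtractf[symmetric]
      by (intro sum.cong HOL.refl) (auto simp: vec_eq_iff algebra_simps)
    then show ?thesis
      by (simp add: basis_expansion)
  qed
  have "\<forall>v. v v* N = 0 \<longleftrightarrow> (\<exists>c. v = c *s l)"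
    using k by (auto simp: N)
  then show ?thesis by (rule that)
qed


section \<open>Derivations that annihilate a product of linear forms\<close>

lemma vf_apply_mult: "vf_apply a (p * q) = vf_apply a p * q + p * vf_apply a q"
  by (simp add: vf_apply_def mderiv_mult algebra_simps sum.distrib sum_distrib_left)

lemma vf_apply_mconst [simp]: "vf_apply a (mconst c) = 0"
  by (simp add: vf_apply_def)

lemma vf_apply_one [simp]: "vf_apply a 1 = 0"
  by (simp add: vf_apply_def)

lemma vf_apply_prod:
  assumes "finite I"
  shows "vf_apply a (prod g I) = (\<Sum>i\<in>I. vf_apply a (g i) * prod g (I - {i}))"
  using assms
proof induction
  case (insert x F)
  have "(\<Sum>i\<in>F. vf_apply a (g i) * prod g (insert x F - {i})) = g x * (\<Sum>i\<in>F. vf_apply a (g i) * prod g (F - {i}))"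
    unfolding sum_distrib_left
  proof (rule sum.cong[OF HOL.refl])
    fix i assume i: "i \<in> F"
    then have "insert x F - {i} = insert x (F - {i})"
      using insert by auto
    then show "vf_apply a (g i) * prod g (insert x F - {i}) = g x * (vf_apply a (g i) * prod g (F - {i}))"
      using insert by (simp add: mult_ac)
  qed
  moreover have "insert x F - {x} = F"
    using insert by auto
  ultimately show ?case
    using insert by (simp add: vf_apply_mult algebra_simps)
qed simp

lemma vf_apply_lform: "vf_apply a (lform l) = (\<Sum>i\<in>UNIV. mconst (l $ i) * a i)"
proof -
  have "mderiv i (lform l) = mconst (l $ i)" for i
    by (simp add: lform_def mderiv_sum mderiv_mult mderiv_mvar if_distrib cong: if_cong)
  then show ?thesis
    by (simp add: vf_apply_def mult.commute)
qed

lemma vf_apply_power: "vf_apply a (p ^ Suc m) = of_nat (Suc m) * p ^ m * vf_apply a p"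
  by (induction m) (simp_all add: vf_apply_mult algebra_simps)

text \<open>
  This is the divisibility \<open>L_k | \<delta>(L_k)\<close> for a derivation \<open>\<delta>\<close> with \<open>\<delta>(\<Prod>i L_i) = 0\<close>, where
  divisibility by \<open>L_k\<close> is expressed by a substitution \<open>N\<close> with kernel \<open>\<complex> L_k\<close> on linear forms.
  Collecting the factors proportional to \<open>L_k\<close>, the product is \<open>C L_k^(m+1) G\<close>, with no factor of \<open>G\<close>
  proportional to \<open>L_k\<close>. After cancelling \<open>C L_k^m\<close>, the equation \<open>\<delta>(\<Prod>i L_i) = 0\<close> reads
  \<open>(m+1) \<delta>(L_k) G + L_k \<delta>(G) = 0\<close>; the substitution kills the second summand but not \<open>G\<close>.
\<close>

lemma vf_apply_vanishes_on_hyperplane: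
  fixes l :: "nat \<Rightarrow> complex^'n::{finite,linorder}"
  assumes nz: "\<And>i. i < d \<Longrightarrow> l i \<noteq> 0" and k: "k < d"
    and log: "vf_apply a (\<Prod>i<d. lform (l i)) = 0"
    and N: "\<And>v. v v* N = 0 \<longleftrightarrow> (\<exists>c. v = c *s l k)"
  shows "linear_change N (vf_apply a (lform (l k))) = 0"
proof -
  define I where "I = {i. i < d \<and> (\<exists>c. l i = c *s l k)}"
  define J where "J = {..<d} - I"
  have IJ: "{..<d} = I \<union> J" "I \<inter> J = {}" "finite I" "finite J"
    by (auto simp: I_def J_def)
  have kI: "k \<in> I"
    using k by (auto simp: I_def intro!: exI[of _ 1])
  obtain c where c: "\<And>i. i \<in> I \<Longrightarrow> l i = c i *s l k"
    using bchoice[of I "\<lambda>i c. l i = c *s l k"] by (auto simp: I_def)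
  define C where "C = (\<Prod>i\<in>I. c i)"
  define G where "G = (\<Prod>i\<in>J. lform (l i))"
  obtain m where m: "card I = Suc m"
    using kI \<open>finite I\<close> by (metis card_gt_0_iff empty_iff gr0_conv_Suc)
  have C: "C \<noteq> 0"
  proof -
    have "c i \<noteq> 0" if "i \<in> I" for i
      using c[OF that] nz[of i] that by (auto simp: I_def)
    then show ?thesis
      unfolding C_def using \<open>finite I\<close> by simp
  qed
  have "(\<Prod>i\<in>I. lform (l i)) = (\<Prod>i\<in>I. mconst (c i) * lform (l k))"
    by (intro prod.cong HOL.refl) (simp add: c lform_scale)
  also have "\<dots> = mconst C * lform (l k) ^ Suc m"
    unfolding prod.distrib m[symmetric] C_def
    by (simp add: prod_constant mconst_prod)
  finally have "(\<Prod>i<d. lform (l i)) = mconst C * (lform (l k) ^ Suc m * G)"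
    unfolding IJ G_def using IJ by (simp add: prod.union_disjoint)
  then have "vf_apply a (lform (l k) ^ Suc m * G) = 0"
    using log C by (simp add: vf_apply_mult mconst_eq_0_iff)
  then have "lform (l k) ^ m * (of_nat (Suc m) * vf_apply a (lform (l k)) * G + lform (l k) * vf_apply a G) = 0"
    by (simp only: vf_apply_mult vf_apply_power) (simp add: algebra_simps)
  then have "of_nat (Suc m) * vf_apply a (lform (l k)) * G + lform (l k) * vf_apply a G = 0"
    using nz[OF k] by (simp add: lform_eq_0_iff)
  then have "linear_change N (of_nat (Suc m) * vf_apply a (lform (l k)) * G + lform (l k) * vf_apply a G) = 0"
    by (simp add: linear_change_simps)
  moreover have "l k v* N = 0"
    using N by (metis vector_smult_lid)
  moreover have "linear_change N (of_nat r) = of_nat r" for r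
    by (induction r) (simp_all add: linear_change_simps)
  ultimately have "of_nat (Suc m) * linear_change N (vf_apply a (lform (l k))) * linear_change N G = 0"
    by (simp add: linear_change_simps linear_change_lform del: of_nat_Suc)
  moreover have "linear_change N G \<noteq> 0"
    using \<open>finite J\<close> N by (auto simp: G_def linear_change_simps linear_change_lform lform_eq_0_iff J_def I_def)
  ultimately show ?thesis
    by (simp del: of_nat_Suc)
qed


section \<open>Homogeneous components\<close>

definition mdeg :: "('n::finite \<Rightarrow>\<^sub>0 nat) \<Rightarrow> nat" where
  "mdeg m = (\<Sum>i\<in>UNIV. Poly_Mapping.lookup m i)"

lemma mdeg_simps [simp]:
  "mdeg 0 = 0" "mdeg (m + m') = mdeg m + mdeg m'" "mdeg (Poly_Mapping.single i k) = k"
  by (simp_all add: mdeg_def lookup_add sum.distrib lookup_single when_def)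

lemma mdeg_eq_0_iff [simp]: "mdeg m = 0 \<longleftrightarrow> m = 0"
  by (auto simp: mdeg_def intro: poly_mapping_eqI)

lemma nonzero_monomial_split:
  fixes m :: "'n \<Rightarrow>\<^sub>0 nat"
  assumes "m \<noteq> 0"
  obtains i m' where "m = m' + Poly_Mapping.single i 1"
proof -
  obtain i where i: "Poly_Mapping.lookup m i \<noteq> 0"
    using assms by (metis lookup_zero poly_mapping_eqI)
  have "m = (m - Poly_Mapping.single i 1) + Poly_Mapping.single i 1"
    using i by (intro poly_mapping_eqI) (auto simp: lookup_add lookup_minus lookup_single when_def)
  then show ?thesis by (rule that)
qed

lift_definition hom_component :: "nat \<Rightarrow> 'n::finite mpoly \<Rightarrow> 'n mpoly" is
  "\<lambda>k p m. if mdeg m = k then p m else 0"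
  by (rule rev_finite_subset) auto

lemma lookup_hom_component:
  "Poly_Mapping.lookup (hom_component k p) m = (if mdeg m = k then Poly_Mapping.lookup p m else 0)"
  by transfer simp

lemma hom_component_0 [simp]: "hom_component k 0 = 0"
  by (rule poly_mapping_eqI) (simp add: lookup_hom_component)

lemma hom_component_add: "hom_component k (p + q) = hom_component k p + hom_component k q"
  by (rule poly_mapping_eqI) (simp add: lookup_hom_component lookup_add)

lemma hom_component_sum: "hom_component k (sum g A) = (\<Sum>i\<in>A. hom_component k (g i))"
  by (induction A rule: infinite_finite_induct) (simp_all add: hom_component_add)

lemma hom_component_single:
  "hom_component k (Poly_Mapping.single m c) = (if mdeg m = k then Poly_Mapping.single m c else 0)"
  by (rule poly_mapping_eqI) (auto simp: lookup_hom_component lookup_single when_def)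

lemma hom_component_single_mult:
  "hom_component (mdeg m + k) (Poly_Mapping.single m c * p) = Poly_Mapping.single m c * hom_component k p"
  by (induction p rule: mpoly_induct) (simp_all add: hom_component_add hom_component_single mult_single algebra_simps)

lemma hom_component_mconst_mult: "hom_component k (mconst c * p) = mconst c * hom_component k p"
  using hom_component_single_mult[of 0 k c p] by (simp add: mconst_def)

lemma hom_component_lform_mult: "hom_component (Suc k) (lform l * p) = lform l * hom_component k p"
proof -
  have "hom_component (Suc k) (Poly_Mapping.single (Poly_Mapping.single i 1) c * p)
      = Poly_Mapping.single (Poly_Mapping.single i 1) c * hom_component k p" for i c
    using hom_component_single_mult[of "Poly_Mapping.single i 1" k] by simp
  then show ?thesis
    by (simp add: lform_def mconst_def mvar_def mult_single sum_distrib_right hom_component_sum)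
qed

lemma hom_component_prod_lform_mult:
  "finite I \<Longrightarrow> hom_component (card I + k) ((\<Prod>i\<in>I. lform (l i)) * p) = (\<Prod>i\<in>I. lform (l i)) * hom_component k p"
  by (induction I arbitrary: p rule: finite_induct) (simp_all add: hom_component_lform_mult mult.assoc)

lemma hom_component_0_eq: "hom_component 0 p = mconst (Poly_Mapping.lookup p 0)"
  by (rule poly_mapping_eqI) (auto simp: lookup_hom_component mconst_def lookup_single when_def)

text \<open>
  The linear part of a polynomial, recorded by its vector of coefficients, so that linear vector
  fields become matrices.
\<close>

lemma hom_component_1_eq: "hom_component 1 p = lform (\<chi> i. Poly_Mapping.lookup p (Poly_Mapping.single i 1))"
proof (induction p rule: mpoly_induct)
  case zero
  show ?case
    by (simp flip: zero_vec_def)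
next
  case (single m c)
  show ?case
  proof (cases "mdeg m = 1")
    case True
    then obtain i m' where "m = m' + Poly_Mapping.single i 1"
      by (metis mdeg_eq_0_iff nonzero_monomial_split one_neq_zero)
    with True have m: "m = Poly_Mapping.single i 1"
      by simp
    have "(\<chi> j. Poly_Mapping.lookup (Poly_Mapping.single m c) (Poly_Mapping.single j 1)) = c *s axis i 1"
    proof -
      have "Poly_Mapping.single i (1::nat) = Poly_Mapping.single j 1 \<longleftrightarrow> j = i" for j
        by (metis lookup_single_eq lookup_single_not_eq one_neq_zero)
      then show ?thesis
        by (auto simp: vec_eq_iff axis_def m lookup_single when_def)
    qed
    moreover have "lform (axis i 1) = (\<Sum>j\<in>UNIV. if j = i then mvar i else 0)"
      unfolding lform_def by (rule sum.cong) (auto simp: axis_def)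
    ultimately show ?thesis
      using True by (simp add: hom_component_single lform_scale) (simp add: m mvar_def mconst_def mult_single)
  next
    case False
    then have "m \<noteq> Poly_Mapping.single j 1" for j
      by auto
    then have "(\<chi> j. Poly_Mapping.lookup (Poly_Mapping.single m c) (Poly_Mapping.single j 1)) = 0"
      by (auto simp: vec_eq_iff lookup_single when_def)
    with False show ?thesis
      by (simp add: hom_component_single)
  qed
next
  case (add p q)
  have "(\<chi> i. Poly_Mapping.lookup (p + q) (Poly_Mapping.single i 1))
      = (\<chi> i. Poly_Mapping.lookup p (Poly_Mapping.single i 1))
        + (\<chi> i. Poly_Mapping.lookup q (Poly_Mapping.single i 1))"
    by (simp add: vec_eq_iff lookup_add)
  then show ?case
    using add by (simp add: hom_component_add lform_add)
qed

lemma vf_apply_hom_component_lform: "vf_apply (\<lambda>i. hom_component k (a i)) (lform l) = hom_component k (vf_apply a (lform l))"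
  by (simp add: vf_apply_lform hom_component_sum hom_component_mconst_mult)

text \<open>
  A product of \<open>d\<close> linear forms is homogeneous, hence \<open>\<delta>(f) = 0\<close> splits into one equation for each
  homogeneous component of \<open>\<delta>\<close>: the summand \<open>\<delta>(L_i) \<Prod>j\<noteq>i L_j\<close> has a factor of degree \<open>d - 1\<close>,
  which shifts degrees by exactly \<open>d - 1\<close>.
\<close>

lemma vf_apply_hom_component_eq_0:
  fixes l :: "nat \<Rightarrow> complex^'n"
  assumes "vf_apply a (\<Prod>i<d. lform (l i)) = 0"
  shows "vf_apply (\<lambda>i. hom_component k (a i)) (\<Prod>i<d. lform (l i)) = 0"
proof -
  have "0 = hom_component (d - 1 + k) (\<Sum>i<d. (\<Prod>j\<in>{..<d} - {i}. lform (l j)) * vf_apply a (lform (l i)))"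
    using assms by (simp add: vf_apply_prod mult.commute)
  also have "\<dots> = (\<Sum>i<d. (\<Prod>j\<in>{..<d} - {i}. lform (l j)) * vf_apply (\<lambda>i. hom_component k (a i)) (lform (l i)))"
    unfolding hom_component_sum
  proof (rule sum.cong[OF HOL.refl])
    fix i assume "i \<in> {..<d}"
    then have "card ({..<d} - {i}) = d - 1"
      by simp
    then show "hom_component (d - 1 + k) ((\<Prod>j\<in>{..<d} - {i}. lform (l j)) * vf_apply a (lform (l i)))
        = (\<Prod>j\<in>{..<d} - {i}. lform (l j)) * vf_apply (\<lambda>i. hom_component k (a i)) (lform (l i))"
      using hom_component_prod_lform_mult[of "{..<d} - {i}" k l] by (simp add: vf_apply_hom_component_lform)
  qed
  also have "\<dots> = vf_apply (\<lambda>i. hom_component k (a i)) (\<Prod>i<d. lform (l i))"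
    by (simp add: vf_apply_prod mult.commute)
  finally show ?thesis by simp
qed


section \<open>Decompositions from linear algebra\<close>

lemma mvars_mult: "mvars (p * q) \<subseteq> mvars p \<union> mvars q"
  using keys_mult[of p q] keys_add unfolding mvars_def by fastforce

lemma mvars_prod: "mvars (prod g I) \<subseteq> (\<Union>i\<in>I. mvars (g i))"
proof (induction I rule: infinite_finite_induct)
  case (insert i I)
  then show ?case
    using mvars_mult[of "g i" "prod g I"] by auto
qed (simp_all add: mvars_def)

lemma mvars_lform: "mvars (lform v) \<subseteq> {i. v $ i \<noteq> 0}"
proof
  fix j assume "j \<in> mvars (lform v)"
  then obtain m where m: "m \<in> Poly_Mapping.keys (lform v)" "j \<in> Poly_Mapping.keys m"
    by (auto simp: mvars_def)
  have "m \<in> (\<Union>i\<in>UNIV. Poly_Mapping.keys (mconst (v $ i) * mvar i))"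
    using m(1) keys_sum[of "\<lambda>i. mconst (v $ i) * mvar i" UNIV] unfolding lform_def by blast
  then obtain i where "m \<in> Poly_Mapping.keys (mconst (v $ i) * mvar i)"
    by blast
  then have "m = Poly_Mapping.single i 1" "v $ i \<noteq> 0"
    by (auto simp: mconst_def mvar_def mult_single split: if_splits)
  with m(2) show "j \<in> {i. v $ i \<noteq> 0}"
    by simp
qed

lemma axis_vector_matrix_mult: "axis i 1 v* M = M $ i"
  for M :: "complex^'m^'n"
proof -
  have "axis i 1 v* M = (\<Sum>j\<in>UNIV. if j = i then M $ i else 0)"
    unfolding vector_matrix_mult_rows by (rule sum.cong) (auto simp: axis_def vec_eq_iff)
  then show ?thesis by simp
qed

lemma vector_matrix_mult_scale: "(c *s v) v* M = c *s (v v* M)"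
  for M :: "complex^'m^'n"
  by (simp add: vec_eq_iff vector_matrix_mult_def sum_distrib_left algebra_simps)

text \<open>
  The change of coordinates that takes the basis \<open>B\<close> of the dual space to the coordinate functions
  makes every form in the span of \<open>B1\<close> depend only on the variables that correspond to \<open>B1\<close>, and every
  form in the span of \<open>B - B1\<close> only on the others.
\<close>

lemma decomposable_of_split_basis:
  fixes l :: "nat \<Rightarrow> complex^'n"
  assumes B: "vec.independent B" "vec.span B = UNIV"
    and B1: "B1 \<subseteq> B" "B1 \<noteq> {}" "B1 \<noteq> B"
    and l: "\<And>i. i < d \<Longrightarrow> l i \<in> vec.span B1 \<or> l i \<in> vec.span (B - B1)"
  shows "decomposable (\<Prod>i<d. lform (l i))"
proof -
  have "card B = CARD('n)"
    using vec.basis_card_eq_dim[of B UNIV] B by (simp add: card_cart_basis)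
  moreover have "finite B"
    using B(1) by (rule vec.finiteI_independent)
  ultimately obtain \<phi> :: "'n \<Rightarrow> complex^'n" where \<phi>: "bij_betw \<phi> UNIV B"
    by (metis finite_class.finite_UNIV finite_same_card_bij)
  define R where "R = (\<chi> i. \<phi> i)"
  have "rows R = B"
    using \<phi> by (auto simp: rows_def R_def row_def bij_betw_def)
  then obtain A where A: "A ** R = mat 1"
    using matrix_left_invertible_span_rows_gen[of R] B by auto
  then have RA: "R ** A = mat 1"
    by (simp add: matrix_left_right_inverse)
  have row: "\<phi> i v* A = axis i 1" for i
  proof -
    have "\<phi> i v* A = axis i 1 v* (R ** A)"
      by (simp add: axis_vector_matrix_mult R_def flip: vector_matrix_mul_assoc)
    then show ?thesis
      by (simp add: RA)
  qed
  have supp: "(v v* A) $ j = 0" if "v \<in> vec.span C" "C \<subseteq> B" "\<phi> j \<notin> C" for v C j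
    using that(1)
  proof (induction rule: vec.span_induct)
    case base
    show ?case
      by (auto simp: vec.subspace_def vector_matrix_left_distrib vector_matrix_mult_scale)
  next
    case (step v)
    then have "v \<in> range \<phi>" "v \<noteq> \<phi> j"
      using that(2,3) \<phi> by (auto simp: bij_betw_def)
    then obtain i where "v = \<phi> i" "i \<noteq> j"
      by blast
    then show ?case
      by (simp add: row axis_def)
  qed
  define S where "S = {i. \<phi> i \<in> B1}"
  define I where "I = {i. i < d \<and> l i \<in> vec.span B1}"
  let ?F = "\<lambda>i. lform (l i v* A)"
  have "invertible A"
    using A RA unfolding invertible_def by blast
  moreover have "S \<noteq> {}" "- S \<noteq> {}"
  proof -
    obtain u v where "u \<in> B1" "v \<in> B" "v \<notin> B1"
      using B1 by blast
    moreover then have "u \<in> range \<phi>" "v \<in> range \<phi>"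
      using \<phi> B1(1) by (auto simp: bij_betw_def)
    ultimately show "S \<noteq> {}" "- S \<noteq> {}"
      by (auto simp: S_def)
  qed
  moreover have "mvars (prod ?F I) \<subseteq> S"
  proof -
    have "mvars (?F i) \<subseteq> S" if "i \<in> I" for i
      using mvars_lform[of "l i v* A"] supp[of "l i" B1] that B1 by (auto simp: I_def S_def)
    then show ?thesis
      using mvars_prod[of ?F I] by blast
  qed
  moreover have "mvars (prod ?F ({..<d} - I)) \<subseteq> - S"
  proof -
    have "mvars (?F i) \<subseteq> - S" if "i \<in> {..<d} - I" for i
    proof -
      have "l i \<in> vec.span (B - B1)"
        using l that by (auto simp: I_def)
      then show ?thesis
        using mvars_lform[of "l i v* A"] supp[of "l i" "B - B1"] by (auto simp: S_def)
    qed
    then show ?thesis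
      using mvars_prod[of ?F "{..<d} - I"] by blast
  qed
  moreover have "linear_change A (\<Prod>i<d. lform (l i)) = prod ?F I * prod ?F ({..<d} - I)"
  proof -
    have "prod ?F {..<d} = prod ?F ({..<d} - I) * prod ?F I"
      by (rule prod.subset_diff) (auto simp: I_def)
    then show ?thesis
      by (simp only: linear_change_simps linear_change_lform mult.commute)
  qed
  ultimately show ?thesis
    unfolding decomposable_def by blast
qed

text \<open>
  A common zero \<open>c \<noteq> 0\<close> of all forms would place them in the proper subspace orthogonal to \<open>c\<close>,
  which is nonzero because it contains the forms; any complement of that subspace gives a
  decomposition with a constant second factor.
\<close>

lemma indecomposable_imp_essential:
  fixes l :: "nat \<Rightarrow> complex^'n"
  assumes d: "0 < d" and nz: "\<And>i. i < d \<Longrightarrow> l i \<noteq> 0"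
    and indec: "\<not> decomposable (\<Prod>i<d. lform (l i))"
    and perp: "\<And>i. i < d \<Longrightarrow> (\<Sum>j\<in>UNIV. l i $ j * c $ j) = 0"
  shows "c = 0"
proof (rule ccontr)
  assume c: "c \<noteq> 0"
  define U where "U = {v. (\<Sum>j\<in>UNIV. v $ j * c $ j) = 0}"
  have U: "vec.subspace U"
  proof -
    have "(\<Sum>j\<in>UNIV. (x + y) $ j * c $ j) = (\<Sum>j\<in>UNIV. x $ j * c $ j) + (\<Sum>j\<in>UNIV. y $ j * c $ j)" for x y
      unfolding sum.distrib[symmetric] by (rule sum.cong) (simp_all add: algebra_simps)
    moreover have "(\<Sum>j\<in>UNIV. (a *s x) $ j * c $ j) = a * (\<Sum>j\<in>UNIV. x $ j * c $ j)" for a x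
      unfolding sum_distrib_left by (rule sum.cong) (simp_all add: mult.assoc)
    ultimately show ?thesis
      unfolding vec.subspace_def U_def by auto
  qed
  obtain k where k: "c $ k \<noteq> 0"
    using c by (auto simp: vec_eq_iff)
  have "(\<Sum>j\<in>UNIV. axis k 1 $ j * c $ j) = (\<Sum>j\<in>UNIV. if j = k then c $ k else 0)"
    by (rule sum.cong) (auto simp: axis_def)
  with k have kU: "axis k 1 \<notin> U"
    by (simp add: U_def)
  obtain B1 where B1: "B1 \<subseteq> U" "vec.independent B1" "U \<subseteq> vec.span B1"
    by (rule vec.basis_exists[of U])
  have span: "vec.span B1 = U"
    using B1 U by (metis vec.span_minimal subset_antisym)
  let ?B = "vec.extend_basis B1"
  have lU: "l i \<in> vec.span B1" if "i < d" for i
    using perp[OF that] by (simp add: span U_def)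
  have "B1 \<noteq> {}"
    using lU[OF d] nz[OF d] by auto
  moreover have "B1 \<noteq> ?B"
    using kU span vec.span_extend_basis[OF B1(2)] by auto
  ultimately have "decomposable (\<Prod>i<d. lform (l i))"
    using vec.extend_basis_superset[OF B1(2)] lU
    by (intro decomposable_of_split_basis[OF vec.independent_extend_basis[OF B1(2)]
        vec.span_extend_basis[OF B1(2)], of B1]) auto
  with indec show False ..
qed

text \<open>
  \<open>N\<close> is the polynomial \<open>\<Prod>\<nu>\<in>\<Lambda>. (t - \<nu>)\<close> evaluated at \<open>M\<close>: it kills the eigenvectors with eigenvalue
  in \<open>\<Lambda>\<close> and is invertible on the other eigenspaces. It serves to separate one eigenspace from the
  span of the others.
\<close>

lemma annihilating_matrix:
  fixes M :: "complex^'n^'n"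
  assumes "finite \<Lambda>"
  obtains N :: "complex^'n^'n"
    where "\<And>v \<mu>. v v* M = \<mu> *s v \<Longrightarrow> v v* N = (\<Prod>\<nu>\<in>\<Lambda>. \<mu> - \<nu>) *s v"
proof -
  have "\<exists>N :: complex^'n^'n. \<forall>v \<mu>. v v* M = \<mu> *s v \<longrightarrow> v v* N = (\<Prod>\<nu>\<in>\<Lambda>. \<mu> - \<nu>) *s v"
    using assms
  proof induction
    case empty
    then show ?case
      by (intro exI[of _ "mat 1"]) simp
  next
    case (insert \<nu> \<Lambda>)
    then obtain N :: "complex^'n^'n" where N: "\<And>v \<mu>. v v* M = \<mu> *s v \<Longrightarrow> v v* N = (\<Prod>\<nu>\<in>\<Lambda>. \<mu> - \<nu>) *s v"
      by blast
    have shift: "v v* (M - mat \<nu>) = v v* M - \<nu> *s v" for v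
    proof -
      have "mat \<nu> $ i = \<nu> *s axis i 1" for i :: 'n
        by (auto simp: mat_def axis_def vec_eq_iff)
      then have "v v* mat \<nu> = \<nu> *s (\<Sum>i\<in>UNIV. (v $ i) *s axis i 1)"
        unfolding vector_matrix_mult_rows by (simp add: vec.scale_sum_right mult.commute)
      then show ?thesis
        by (simp add: vector_matrix_mult_diff_rdistrib basis_expansion)
    qed
    show ?case
    proof (intro exI[of _ "N ** (M - mat \<nu>)"] allI impI)
      fix v \<mu> assume v: "v v* M = \<mu> *s v"
      show "v v* (N ** (M - mat \<nu>)) = (\<Prod>\<nu>\<in>insert \<nu> \<Lambda>. \<mu> - \<nu>) *s v"
        using insert
        by (simp add: N[OF v] shift vector_matrix_mult_scale v flip: vector_matrix_mul_assoc)
          (simp add: vec_eq_iff algebra_simps)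
    qed
  qed
  then show ?thesis using that by blast
qed

text \<open>
  Each \<open>l i\<close> lies in some eigenspace. If one eigenspace \<open>U\<close> were not the whole space, a basis
  of \<open>U\<close> could be completed first by forms \<open>l i\<close> outside \<open>U\<close> and then to a basis of the dual space.
  The forms \<open>l i\<close> outside \<open>U\<close> lie in the span of the added vectors, as eigenvectors for different
  eigenvalues are independent, so the arrangement would decompose.
\<close>

lemma indecomposable_imp_scalar:
  fixes l :: "nat \<Rightarrow> complex^'n" and M :: "complex^'n^'n"
  assumes d: "0 < d" and nz: "\<And>i. i < d \<Longrightarrow> l i \<noteq> 0"
    and indec: "\<not> decomposable (\<Prod>i<d. lform (l i))"
    and eigen: "\<And>i. i < d \<Longrightarrow> \<exists>\<mu>. l i v* M = \<mu> *s l i"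
  obtains \<mu> where "\<forall>v. v v* M = \<mu> *s v"
proof -
  obtain \<mu> where \<mu>: "\<And>i. i < d \<Longrightarrow> l i v* M = \<mu> i *s l i"
    using eigen by metis
  define U where "U = {v. v v* M = \<mu> 0 *s v}"
  have U: "vec.subspace U"
    by (auto simp: vec.subspace_def U_def vector_matrix_left_distrib vector_matrix_mult_scale
      vec.scale_right_distrib mult.commute)
  have "U = UNIV"
  proof (rule ccontr)
    assume proper: "U \<noteq> UNIV"
    obtain B1 where B1: "B1 \<subseteq> U" "vec.independent B1" "U \<subseteq> vec.span B1"
      by (rule vec.basis_exists[of U])
    have span: "vec.span B1 = U"
      using B1 U by (metis vec.span_minimal subset_antisym)
    define X where "X = {l i | i. i < d \<and> l i \<notin> U}"
    obtain B' where B': "B1 \<subseteq> B'" "B' \<subseteq> B1 \<union> X" "vec.independent B'" "B1 \<union> X \<subseteq> vec.span B'"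
      using vec.maximal_independent_subset_extend[of B1 "B1 \<union> X"] B1(2) by blast
    let ?B = "vec.extend_basis B'"
    note B = vec.independent_extend_basis[OF B'(3)] vec.span_extend_basis[OF B'(3)]
      vec.extend_basis_superset[OF B'(3)]
    define \<Lambda> where "\<Lambda> = \<mu> ` {i. i < d \<and> l i \<notin> U}"
    obtain N :: "complex^'n^'n" where N: "\<And>v \<nu>. v v* M = \<nu> *s v \<Longrightarrow> v v* N = (\<Prod>\<kappa>\<in>\<Lambda>. \<nu> - \<kappa>) *s v"
      by (rule annihilating_matrix[of \<Lambda> M]) (auto simp: \<Lambda>_def)
    have "finite \<Lambda>"
      by (simp add: \<Lambda>_def)
    have "\<mu> 0 \<notin> \<Lambda>"
      using \<mu> by (auto simp: \<Lambda>_def U_def)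
    then have nz0: "(\<Prod>\<kappa>\<in>\<Lambda>. \<mu> 0 - \<kappa>) \<noteq> 0"
      using \<open>finite \<Lambda>\<close> by auto
    have kill: "v v* N = 0" if "v \<in> vec.span X" for v
      using that
    proof (induction rule: vec.span_induct)
      case base
      show ?case
        by (auto simp: vec.subspace_def vector_matrix_left_distrib vector_matrix_mult_scale)
    next
      case (step v)
      then obtain i where i: "v = l i" "i < d" "l i \<notin> U"
        by (auto simp: X_def)
      then have "(\<Prod>\<kappa>\<in>\<Lambda>. \<mu> i - \<kappa>) = 0"
        using \<open>finite \<Lambda>\<close> by (auto simp: \<Lambda>_def)
      then show ?case
        using N[OF \<mu>[OF i(2)]] i(1) by simp
    qed
    have split: "l i \<in> vec.span B1 \<or> l i \<in> vec.span (?B - B1)" if i: "i < d" for i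
    proof (cases "l i \<in> U")
      case False
      then have lX: "l i \<in> X"
        using i by (auto simp: X_def)
      have "B1 \<union> (B' - B1) = B'"
        using B' by auto
      then have "l i \<in> vec.span (B1 \<union> (B' - B1))"
        using B'(4) lX by auto
      then obtain u v where uv: "l i = u + v" "u \<in> vec.span B1" "v \<in> vec.span (B' - B1)"
        unfolding vec.span_Un by blast
      \<comment> \<open>\<open>N\<close> kills \<open>l i\<close> and \<open>v\<close> and acts on \<open>u\<close> as a nonzero scalar, so \<open>u = 0\<close>.\<close>
      have "B' - B1 \<subseteq> X"
        using B' by auto
      then have "v v* N = 0" "l i v* N = 0"
        using uv(3) kill vec.span_mono[of "B' - B1" X] vec.span_base[OF lX] by blast+
      then have "u v* N = 0"
        unfolding uv(1) by (simp add: vector_matrix_left_distrib)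
      moreover have "u v* N = (\<Prod>\<kappa>\<in>\<Lambda>. \<mu> 0 - \<kappa>) *s u"
        using uv(2) by (intro N) (simp add: span U_def)
      ultimately have "u = 0"
        using nz0 by simp
      then show ?thesis
        using uv vec.span_mono[of "B' - B1" "?B - B1"] B(3) by auto
    qed (simp add: span)
    have "l 0 \<in> vec.span B1"
      using \<mu>[OF d] by (simp add: span U_def)
    then have "B1 \<noteq> {}"
      using nz[OF d] by auto
    moreover have "B1 \<noteq> ?B"
      using span proper B(2) by auto
    ultimately have "decomposable (\<Prod>i<d. lform (l i))"
      using B B'(1) split by (intro decomposable_of_split_basis[of ?B B1]) auto
    with indec show False ..
  qed
  then show ?thesis
    using that unfolding U_def by blast
qed


section \<open>Constant and linear part of a logarithmic derivation\<close>

text \<open>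
  Constant part: a constant field \<open>c\<close> has \<open>L_i | c(L_i)\<close>, which by degree means \<open>c(L_i) = 0\<close>, so \<open>c = 0\<close>.
  Linear part: a linear field with matrix \<open>M\<close> has every \<open>L_i\<close> as eigenvector, hence is \<open>\<mu>\<close> times the
  Euler field, and \<open>0 = \<delta>(f) = \<mu> d f\<close> forces \<open>\<mu> = 0\<close>.
\<close>

lemma log_derivation_vanishes:
  fixes l :: "nat \<Rightarrow> complex^'n::{finite,linorder}"
  assumes d: "0 < d" and nz: "\<And>i. i < d \<Longrightarrow> l i \<noteq> 0"
    and indec: "\<not> decomposable (\<Prod>i<d. lform (l i))"
    and log: "vf_apply a (\<Prod>i<d. lform (l i)) = 0"
  shows "Poly_Mapping.lookup (a i) 0 = 0"
    and "Poly_Mapping.lookup (a i) (Poly_Mapping.single j 1) = 0"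
proof -
  let ?f = "\<Prod>i<d. lform (l i)"
  have log_k: "vf_apply (\<lambda>i. hom_component k (a i)) ?f = 0" for k
    using log by (rule vf_apply_hom_component_eq_0)
  define c where "c = (\<chi> i. Poly_Mapping.lookup (a i) 0)"
  have "c = 0"
  proof (rule indecomposable_imp_essential[OF d nz indec])
    fix i assume i: "i < d"
    obtain N :: "((complex, 'n) vec, 'n) vec" where N: "\<forall>v. v v* N = 0 \<longleftrightarrow> (\<exists>c. v = c *s l i)"
      by (rule exists_matrix_kernel_line[OF nz[OF i]])
    have "vf_apply (\<lambda>i. hom_component 0 (a i)) (lform (l i)) = mconst (\<Sum>j\<in>UNIV. l i $ j * c $ j)"
      by (simp add: vf_apply_lform hom_component_0_eq c_def mconst_sum mconst_mult)
    with vf_apply_vanishes_on_hyperplane[OF nz i log_k[of 0] N[rule_format]]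
    show "(\<Sum>j\<in>UNIV. l i $ j * c $ j) = 0"
      by (simp add: linear_change_simps mconst_eq_0_iff)
  qed
  then have "c $ i = 0"
    by simp
  then show "Poly_Mapping.lookup (a i) 0 = 0"
    by (simp add: c_def)
  define M where
    "M = (\<chi> i j. Poly_Mapping.lookup (a i) (Poly_Mapping.single j 1))"
  have lin: "vf_apply (\<lambda>i. hom_component 1 (a i)) (lform v) = lform (v v* M)" for v
    unfolding vf_apply_lform hom_component_1_eq vector_matrix_mult_rows lform_sum lform_scale M_def by simp
  have eigen: "\<exists>\<mu>. l i v* M = \<mu> *s l i" if i: "i < d" for i
  proof -
    obtain N :: "((complex, 'n) vec, 'n) vec" where N: "\<forall>v. v v* N = 0 \<longleftrightarrow> (\<exists>c. v = c *s l i)"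
      by (rule exists_matrix_kernel_line[OF nz[OF i]])
    from vf_apply_vanishes_on_hyperplane[OF nz i log_k[of 1] N[rule_format]] have "(l i v* M) v* N = 0"
      unfolding lin linear_change_lform lform_eq_0_iff .
    then show ?thesis
      using N by simp
  qed
  obtain \<mu> where \<mu>: "\<forall>v. v v* M = \<mu> *s v"
    by (rule indecomposable_imp_scalar[OF d nz indec eigen])
  \<comment> \<open>Applying the linear part, now \<open>\<mu>\<close> times the Euler field, to \<open>f\<close> gives \<open>d \<mu> f = 0\<close>.\<close>
  have "0 = (\<Sum>i<d. vf_apply (\<lambda>i. hom_component 1 (a i)) (lform (l i)) * (\<Prod>j\<in>{..<d} - {i}. lform (l j)))"
    using log_k[of 1] by (simp add: vf_apply_prod)
  also have "\<dots> = (\<Sum>i<d. mconst \<mu> * ?f)"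
    unfolding lin \<mu>[rule_format] lform_scale
  proof (rule sum.cong[OF HOL.refl])
    fix i assume "i \<in> {..<d}"
    then have f: "?f = lform (l i) * (\<Prod>j\<in>{..<d} - {i}. lform (l j))"
      by (rule prod.remove[OF finite_lessThan])
    show "mconst \<mu> * lform (l i) * (\<Prod>j\<in>{..<d} - {i}. lform (l j)) = mconst \<mu> * ?f"
      unfolding f by (rule mult.assoc)
  qed
  also have "\<dots> = of_nat d * (mconst \<mu> * ?f)"
    by simp
  finally have "\<mu> = 0"
    using d nz by (auto simp: mconst_eq_0_iff lform_eq_0_iff)
  then have "M $ i = 0"
    using \<mu>[rule_format, of "axis i 1"] unfolding axis_vector_matrix_mult by simp
  then have "M $ i $ j = 0"
    by simp
  then show "Poly_Mapping.lookup (a i) (Poly_Mapping.single j 1) = 0"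
    by (simp add: M_def)
qed


section \<open>Elements of the Weyl algebra\<close>

lemma weyl_poly_0 [simp]: "weyl_poly 0 = 0"
  by transfer (rule weyl_rel.refl)

lemma weyl_poly_1 [simp]: "weyl_poly 1 = 1"
  by transfer (rule weyl_rel.refl)

lemma weyl_poly_add: "weyl_poly (p + q) = weyl_poly p + weyl_poly q"
  by transfer (rule weyl_rel.sym, rule weyl_rel.poly_add)

lemma weyl_poly_mult: "weyl_poly (p * q) = weyl_poly p * weyl_poly q"
  by transfer (rule weyl_rel.sym, rule weyl_rel.poly_mult)

lemma weyl_poly_uminus: "weyl_poly (- p) = - weyl_poly p"
  using weyl_poly_add[of p "- p"] by (simp add: add_eq_0_iff)

lemma weyl_poly_of_nat: "weyl_poly (of_nat k) = of_nat k"
  by (induction k) (simp_all add: weyl_poly_add)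

lemma weyl_poly_sum: "weyl_poly (sum g A) = (\<Sum>i\<in>A. weyl_poly (g i))"
  by (induction A rule: infinite_finite_induct) (simp_all add: weyl_poly_add)

lemma weyl_D_poly: "weyl_D i * weyl_poly p = weyl_poly p * weyl_D i + weyl_poly (mderiv i p)"
  by transfer (rule weyl_rel.D_poly)

text \<open>
  Centrality of the scalars holds for the generators and is stable under the ring operations.
\<close>

lemma weyl_poly_mconst_central: "weyl_poly (mconst c) * P = P * weyl_poly (mconst c)"
proof (induction P rule: weyl.abs_induct)
  case (1 e)
  show ?case
  proof (induction e)
    case (WPoly p)
    have "abs_weyl (WPoly p) = weyl_poly p"
      by (simp add: weyl_poly_def)
    then show ?case
      by (simp add: mult.commute flip: weyl_poly_mult)
  next
    case (WD i)
    have "abs_weyl (WD i) = weyl_D i"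
      by (simp add: weyl_D_def)
    then show ?case
      by (simp add: weyl_D_poly)
  next
    case (WAdd a b)
    then show ?case
      by (simp add: algebra_simps flip: plus_weyl.abs_eq)
  next
    case (WNeg a)
    then show ?case
      by (simp flip: uminus_weyl.abs_eq)
  next
    case (WMul a b)
    then show ?case
      by (metis mult.assoc times_weyl.abs_eq)
  qed
qed


section \<open>The left ideal generated by the variables\<close>

lemma left_ideal_zero: "0 \<in> left_ideal S"
  unfolding left_ideal_def by (auto intro!: exI[of _ "{}"])

lemma left_ideal_base: "x \<in> S \<Longrightarrow> x \<in> left_ideal S"
  unfolding left_ideal_def by (auto intro!: exI[of _ "{x}"] exI[of _ "\<lambda>_. 1"])

lemma left_ideal_add:
  assumes "x \<in> left_ideal S" "y \<in> left_ideal S"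
  shows "x + y \<in> left_ideal S"
proof -
  obtain T c U e where T: "finite T" "T \<subseteq> S" "x = (\<Sum>t\<in>T. c t * t)"
    and U: "finite U" "U \<subseteq> S" "y = (\<Sum>t\<in>U. e t * t)"
    using assms unfolding left_ideal_def by blast
  define c' where "c' t = (if t \<in> T then c t else 0) + (if t \<in> U then e t else 0)" for t
  have "x = (\<Sum>t\<in>T \<union> U. (if t \<in> T then c t else 0) * t)"
    unfolding T(3) using T(1) U(1) by (intro sum.mono_neutral_cong_left) auto
  moreover have "y = (\<Sum>t\<in>T \<union> U. (if t \<in> U then e t else 0) * t)"
    unfolding U(3) using T(1) U(1) by (intro sum.mono_neutral_cong_left) auto
  ultimately have "x + y = (\<Sum>t\<in>T \<union> U. c' t * t)"
    by (simp only: c'_def ring_distribs sum.distrib)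
  then show ?thesis
    using T U unfolding left_ideal_def by blast
qed

lemma left_ideal_mult:
  assumes "x \<in> left_ideal S"
  shows "y * x \<in> left_ideal S"
proof -
  obtain T c where T: "finite T" "T \<subseteq> S" "x = (\<Sum>t\<in>T. c t * t)"
    using assms unfolding left_ideal_def by blast
  then have "y * x = (\<Sum>t\<in>T. (y * c t) * t)"
    by (simp add: sum_distrib_left mult.assoc)
  with T(1,2) show ?thesis
    unfolding left_ideal_def mem_Collect_eq by (intro exI[of _ T] exI[of _ "\<lambda>t. y * c t"]) simp
qed

lemma left_ideal_uminus: "x \<in> left_ideal S \<Longrightarrow> - x \<in> left_ideal S"
  using left_ideal_mult[of x S "- 1"] by simp

lemma left_ideal_diff: "x \<in> left_ideal S \<Longrightarrow> y \<in> left_ideal S \<Longrightarrow> x - y \<in> left_ideal S"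
  using left_ideal_add[of x S "- y"] left_ideal_uminus[of y S] by simp

lemma left_ideal_sum: "(\<And>i. i \<in> A \<Longrightarrow> g i \<in> left_ideal S) \<Longrightarrow> sum g A \<in> left_ideal S"
  by (induction A rule: infinite_finite_induct) (auto simp: left_ideal_zero left_ideal_add)

lemma left_ideal_subset:
  assumes "S \<subseteq> left_ideal T"
  shows "left_ideal S \<subseteq> left_ideal T"
proof
  fix x assume "x \<in> left_ideal S"
  then obtain U c where U: "U \<subseteq> S" "x = (\<Sum>t\<in>U. c t * t)"
    unfolding left_ideal_def by blast
  show "x \<in> left_ideal T"
    unfolding U(2) using U(1) assms by (intro left_ideal_sum left_ideal_mult) blast
qed

abbreviation var_ideal :: "'n::finite weyl set" where
  "var_ideal \<equiv> left_ideal (weyl_poly ` mvar ` UNIV)"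

lemma weyl_poly_mvar_in_ideal: "weyl_poly (mvar i) \<in> var_ideal"
  by (rule left_ideal_base) simp

lemma weyl_poly_in_var_ideal:
  assumes "Poly_Mapping.lookup p 0 = 0"
  shows "weyl_poly p \<in> var_ideal"
proof -
  have "weyl_poly (Poly_Mapping.single m c) \<in> var_ideal" if "m \<noteq> 0" for m c
  proof -
    obtain i m' where "m = m' + Poly_Mapping.single i 1"
      using nonzero_monomial_split[OF \<open>m \<noteq> 0\<close>] .
    then have "Poly_Mapping.single m c = Poly_Mapping.single m' c * mvar i"
      by (simp add: mvar_def mult_single)
    then show ?thesis
      by (simp add: weyl_poly_mult left_ideal_mult weyl_poly_mvar_in_ideal)
  qed
  moreover have "m \<noteq> 0" if "m \<in> Poly_Mapping.keys p" for m
    using that assms by (auto simp: in_keys_iff)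
  ultimately show ?thesis
    by (subst mpoly_sum_singles) (auto simp: weyl_poly_sum intro!: left_ideal_sum)
qed

text \<open>
  Moving the derivatives to the left, \<open>\<Sum>i a_i \<partial>_i = \<Sum>i (\<partial>_i a_i - \<partial>a_i/\<partial>x_i)\<close>, and the hypotheses
  say that both \<open>a_i\<close> and \<open>\<partial>a_i/\<partial>x_i\<close> vanish at the origin.
\<close>

lemma vf_weyl_in_var_ideal:
  assumes "\<And>i. Poly_Mapping.lookup (a i) 0 = 0"
    and "\<And>i. Poly_Mapping.lookup (a i) (Poly_Mapping.single i 1) = 0"
  shows "vf_weyl a \<in> var_ideal"
proof -
  have "weyl_poly (a i) * weyl_D i = weyl_D i * weyl_poly (a i) - weyl_poly (mderiv i (a i))" for i
    by (simp add: weyl_D_poly)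
  moreover have "Poly_Mapping.lookup (mderiv i (a i)) 0 = 0" for i
    using assms by (simp add: lookup_mderiv)
  ultimately show ?thesis
    unfolding vf_weyl_def using assms
    by (auto intro!: left_ideal_sum left_ideal_diff left_ideal_mult weyl_poly_in_var_ideal)
qed


section \<open>The left ideal generated by the variables is proper\<close>

text \<open>
  The right action of the Weyl algebra on polynomials, that is, the action of the formal adjoint:
  products are reversed and \<open>\<partial>_i\<close> acts as \<open>- \<partial>/\<partial>x_i\<close>. It serves to show that \<open>D_n (x_1, ..., x_n)\<close>
  is a proper left ideal: in the standard action no nonzero element is killed by the variables,
  whereas here \<open>P x_i\<close> takes values in the multiples of \<open>x_i\<close>.
\<close>

primrec weyl_expr_transpose :: "'n weyl_expr \<Rightarrow> 'n mpoly \<Rightarrow> 'n mpoly" where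
  "weyl_expr_transpose (WPoly p) = (*) p"
| "weyl_expr_transpose (WD i) = (\<lambda>g. - mderiv i g)"
| "weyl_expr_transpose (WAdd a b) = (\<lambda>g. weyl_expr_transpose a g + weyl_expr_transpose b g)"
| "weyl_expr_transpose (WNeg a) = (\<lambda>g. - weyl_expr_transpose a g)"
| "weyl_expr_transpose (WMul a b) = (\<lambda>g. weyl_expr_transpose b (weyl_expr_transpose a g))"

lemma weyl_expr_transpose_add:
  "weyl_expr_transpose e (g + h) = weyl_expr_transpose e g + weyl_expr_transpose e h"
  by (induction e arbitrary: g h) (simp_all add: algebra_simps mderiv_add)

lemma weyl_rel_transpose: "weyl_rel a b \<Longrightarrow> weyl_expr_transpose a = weyl_expr_transpose b"
  by (induction rule: weyl_rel.induct)
    (auto simp: algebra_simps weyl_expr_transpose_add mderiv_mult mderiv_commute mderiv_uminus fun_eq_iff)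

lift_definition weyl_transpose :: "'n weyl \<Rightarrow> 'n mpoly \<Rightarrow> 'n mpoly" is weyl_expr_transpose
  by (rule weyl_rel_transpose)

lemma weyl_transpose_0: "weyl_transpose 0 g = 0"
  by transfer simp

lemma weyl_transpose_add:
  "weyl_transpose (P + Q) g = weyl_transpose P g + weyl_transpose Q g"
  by transfer simp

lemma weyl_transpose_mult:
  "weyl_transpose (P * Q) g = weyl_transpose Q (weyl_transpose P g)"
  by transfer simp

lemma weyl_transpose_poly: "weyl_transpose (weyl_poly p) g = p * g"
  by transfer simp

lemmas weyl_transpose_simps =
  weyl_transpose_0 weyl_transpose_add weyl_transpose_mult weyl_transpose_poly

lemma lookup_mvar_mult_0: "Poly_Mapping.lookup (mvar i * p) 0 = 0"
proof (induction p rule: mpoly_induct)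
  case (single m c)
  have "Poly_Mapping.single i (1::nat) + m \<noteq> 0"
  proof
    assume "Poly_Mapping.single i (1::nat) + m = 0"
    then have "Poly_Mapping.lookup (Poly_Mapping.single i (1::nat) + m) i = 0" by simp
    then show False by (simp add: lookup_add)
  qed
  then show ?case
    by (simp add: mvar_def mult_single lookup_single when_def)
qed (simp_all add: lookup_add ring_distribs)

text \<open>
  The adjoint of \<open>P x_i\<close> is multiplication by \<open>x_i\<close> after the adjoint of \<open>P\<close>, so its values vanish at
  the origin.
\<close>

lemma lookup_weyl_transpose_var_ideal:
  assumes "P \<in> var_ideal"
  shows "Poly_Mapping.lookup (weyl_transpose P g) 0 = 0"
proof -
  obtain T c where T: "T \<subseteq> weyl_poly ` mvar ` UNIV" "P = (\<Sum>t\<in>T. c t * t)"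
    using assms unfolding left_ideal_def by blast
  have sum: "weyl_transpose (sum h A) g = (\<Sum>t\<in>A. weyl_transpose (h t) g)" for h :: "'a weyl \<Rightarrow> 'a weyl" and A
    by (induction A rule: infinite_finite_induct) (simp_all add: weyl_transpose_simps)
  show ?thesis
    unfolding T(2) sum lookup_sum
    using T(1) by (intro sum.neutral) (auto simp: weyl_transpose_simps lookup_mvar_mult_0)
qed

lemma weyl_poly_mconst_in_var_ideal:
  assumes "weyl_poly (mconst c) \<in> var_ideal"
  shows "c = 0"
  using lookup_weyl_transpose_var_ideal[OF assms, of 1]
  by (simp add: weyl_transpose_simps mconst_def)


section \<open>The Euler field\<close>

definition euler :: "'n::finite weyl" where
  "euler = vf_weyl mvar"

text \<open>
  The source of the number \<open>n\<close> in the root: \<open>\<Sum>i x_i \<partial>_i = \<Sum>i \<partial>_i x_i - n\<close>.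
\<close>

lemma euler_mod_var_ideal: "euler + of_nat CARD('n) \<in> (var_ideal :: 'n::finite weyl set)"
proof -
  have "weyl_poly (mvar i) * weyl_D i + 1 = weyl_D i * weyl_poly (mvar i)" for i :: 'n
    by (simp add: weyl_D_poly mderiv_mvar)
  then have "(euler + of_nat CARD('n) :: 'n weyl) = (\<Sum>i\<in>UNIV. weyl_D i * weyl_poly (mvar i))"
    unfolding euler_def vf_weyl_def by (simp add: sum.distrib flip: \<open>\<And>i. _ = weyl_D i * weyl_poly (mvar i)\<close>)
  then show ?thesis
    by (auto intro!: left_ideal_sum left_ideal_mult weyl_poly_mvar_in_ideal)
qed

lemma vf_weyl_mult_weyl_poly:
  "vf_weyl a * weyl_poly p = weyl_poly p * vf_weyl a + weyl_poly (vf_apply a p)"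
proof -
  have "weyl_poly (a i) * weyl_D i * weyl_poly p
      = weyl_poly p * (weyl_poly (a i) * weyl_D i) + weyl_poly (a i * mderiv i p)" for i
  proof -
    have "weyl_poly (a i) * weyl_D i * weyl_poly p
        = (weyl_poly (a i) * weyl_poly p) * weyl_D i + weyl_poly (a i) * weyl_poly (mderiv i p)"
      by (simp add: mult.assoc weyl_D_poly) (simp add: algebra_simps)
    also have "weyl_poly (a i) * weyl_poly p = weyl_poly p * weyl_poly (a i)"
      by (simp add: mult.commute flip: weyl_poly_mult)
    finally show ?thesis
      by (simp add: mult.assoc weyl_poly_mult)
  qed
  then show ?thesis
    by (simp add: vf_weyl_def vf_apply_def weyl_poly_sum sum_distrib_left sum_distrib_right sum.distrib)
qed

lemma vf_apply_mvar_prod_lform: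
  "vf_apply mvar (\<Prod>i<d. lform (l i)) = of_nat d * (\<Prod>i<d. lform (l i))"
proof -
  have E: "vf_apply mvar (lform v) = lform v" for v
    by (simp add: vf_apply_lform) (simp add: lform_def)
  have "vf_apply mvar (\<Prod>i<d. lform (l i)) = (\<Sum>i<d. \<Prod>i<d. lform (l i))"
    unfolding vf_apply_prod[OF finite_lessThan] E
    by (rule sum.cong[OF HOL.refl]) (rule prod.remove[OF finite_lessThan, symmetric])
  then show ?thesis by simp
qed


section \<open>Elimination of \<open>s\<close> from functional equations\<close>

abbreviation svar :: "'n::{finite,linorder} smod" where
  "svar \<equiv> [:0, 1:]"

text \<open>
  The variable \<open>s\<close> is central in \<open>D_n[s]\<close>.
\<close>

lemma weyl_act_svar: "weyl_act f P (svar * m) = svar * weyl_act f P m"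
proof -
  have D: "fs_D f i (svar * m) = svar * fs_D f i m" for i m
    by (rule poly_eqI) (simp add: coeff_fs_D coeff_pCons split: nat.splits)
  have S: "fs_scale p (svar * m) = svar * fs_scale p m" for p m
    by (simp add: fs_scale_def)
  have "weyl_eval fs_scale (fs_D f) e (svar * m) = svar * weyl_eval fs_scale (fs_D f) e m" for e
    by (induction e arbitrary: m) (simp_all only: weyl_eval.simps D S ring_distribs mult_minus_right)
  then show ?thesis
    by (induction P rule: weyl.abs_induct) (simp add: weyl_act.abs_eq)
qed

lemma weyl_act_svar_power: "weyl_act f P (svar ^ j * m) = svar ^ j * weyl_act f P m"
  by (induction j) (simp_all only: power_0 mult_1_left power_Suc mult.assoc weyl_act_svar)

lemma weyl_act_sum: "weyl_act f (sum g A) m = (\<Sum>i\<in>A. weyl_act f (g i) m)"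
  by (induction A rule: infinite_finite_induct) simp_all

lemma Fract_sum:
  assumes "b \<noteq> 0"
  shows "Fract (sum g A) b = (\<Sum>i\<in>A. Fract (g i) b)"
proof (induction A rule: infinite_finite_induct)
  case (insert x A)
  have "Fract (g x + sum g A) b = Fract (g x) b + Fract (sum g A) b"
    using assms by (simp add: eq_fract algebra_simps)
  with insert show ?case by simp
qed (use assms in \<open>simp_all add: Zero_fract_def eq_fract\<close>)

lemma weyl_act_vf_weyl_1:
  assumes "f \<noteq> 0"
  shows "weyl_act f (vf_weyl a) 1 = [:0, Fract (vf_apply a f) f:]"
proof (rule poly_eqI)
  fix j
  have one: "fderiv i 1 = 0" for i
    using fderiv_poly[of i 1] by (simp flip: One_fract_def Zero_fract_def)
  have c1: "coeff (1 :: 'a smod) k = (if k = 0 then 1 else 0)" for k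
    by simp
  show "coeff (weyl_act f (vf_weyl a) 1) j = coeff [:0, Fract (vf_apply a f) f:] j"
    unfolding vf_weyl_def weyl_act_sum coeff_sum weyl_act_simps coeff_fs_scale coeff_fs_D c1
    by (auto simp: vf_apply_def Fract_sum assms coeff_pCons one split: nat.splits)
qed

lemma smod_of_poly_pCons:
  "smod_of_poly (pCons c b) = [:Fract (mconst c) 1:] + svar * smod_of_poly b"
proof -
  have "map_poly (\<lambda>c. Fract (mconst c) 1) (pCons c b)
      = pCons (Fract (mconst c) 1) (map_poly (\<lambda>c. Fract (mconst c) 1) b)"
    by (rule map_poly_pCons) (simp flip: Zero_fract_def)
  then show ?thesis
    by (simp add: smod_of_poly_def)
qed

lemma weyl_act_mconst_1: "weyl_act f (weyl_poly (mconst c)) 1 = [:Fract (mconst c) 1:]"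
  by (simp add: fs_scale_def)

lemma lookup_mult_single_0:
  "Poly_Mapping.lookup (P * Poly_Mapping.single 0 a) j = Poly_Mapping.lookup P j * a"
  for P :: "nat \<Rightarrow>\<^sub>0 'a::semiring_0"
proof -
  have "(\<Sum>q. Poly_Mapping.lookup (Poly_Mapping.single 0 a) q when j = l + q) = (a when j = l)" for l
  proof -
    have "(Poly_Mapping.lookup (Poly_Mapping.single 0 a) q when j = l + q) = ((a when j = l) when q = 0)" for q
      by (auto simp: lookup_single when_def)
    then show ?thesis by simp
  qed
  then show ?thesis
    by (simp add: lookup_mult mult_when)
qed

text \<open>
  An operator \<open>H\<close> of \<open>D_n\<close>, without the variable \<open>s\<close>, that acts on \<open>f^s\<close> as multiplication by \<open>s\<close> and
  is congruent to the scalar \<open>\<gamma>\<close> modulo \<open>D_n (x_1, ..., x_n)\<close>. The commutation rule makes \<open>H - 1\<close> act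
  on \<open>f f^s\<close> as multiplication by \<open>s\<close>, which allows all occurrences of \<open>s\<close> in a functional equation
  to be eliminated. The normalised Euler field has these properties, with \<open>\<gamma> = - n/d\<close>.
\<close>

locale s_operator =
  fixes f :: "'n::{finite,linorder} mpoly" and H :: "'n weyl" and \<gamma> :: complex
  assumes H_1: "weyl_act f H 1 = svar"
    and H_f: "H * weyl_poly f = weyl_poly f * H + weyl_poly f"
    and H_mod: "H - weyl_poly (mconst \<gamma>) \<in> var_ideal"
begin

text \<open>
  The operator is \<open>b(H)\<close>, built by Horner's scheme: modulo the ideal, \<open>H\<close> may be replaced by \<open>\<gamma>\<close>.
\<close>

lemma exists_operator_of_poly:
  "\<exists>B. weyl_act f B 1 = smod_of_poly b \<and> B - weyl_poly (mconst (poly b \<gamma>)) \<in> var_ideal"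
proof (induction b)
  case 0
  show ?case
    by (intro exI[of _ 0]) (simp add: smod_of_poly_def left_ideal_zero)
next
  case (pCons c b)
  then obtain B where B: "weyl_act f B 1 = smod_of_poly b"
    "B - weyl_poly (mconst (poly b \<gamma>)) \<in> var_ideal"
    by blast
  have "weyl_act f (B * H) 1 = weyl_act f B (svar * 1)"
    by (simp add: H_1)
  then have act: "weyl_act f (weyl_poly (mconst c) + B * H) 1 = smod_of_poly (pCons c b)"
    unfolding weyl_act_svar by (simp only: weyl_act_simps(3) weyl_act_mconst_1 B(1) smod_of_poly_pCons)
  have "weyl_poly (mconst c) + B * H - weyl_poly (mconst (poly (pCons c b) \<gamma>))
      = B * (H - weyl_poly (mconst \<gamma>))
        + weyl_poly (mconst \<gamma>) * (B - weyl_poly (mconst (poly b \<gamma>)))"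
    unfolding right_diff_distrib weyl_poly_mconst_central[of \<gamma> B]
    by (simp add: mconst_add mconst_mult weyl_poly_add weyl_poly_mult)
  also have "\<dots> \<in> var_ideal"
    using H_mod B(2) by (intro left_ideal_add left_ideal_mult)
  finally show ?case
    using act by blast
qed

lemma weyl_act_shifted_power:
  "weyl_act f ((H - 1) ^ j * weyl_poly f) 1 = svar ^ j * weyl_act f (weyl_poly f) 1"
proof (induction j)
  case (Suc j)
  have "(H - 1) * weyl_poly f = weyl_poly f * H"
    by (simp add: left_diff_distrib H_f)
  then have "weyl_act f ((H - 1) * weyl_poly f) 1 = weyl_act f (weyl_poly f) (svar * 1)"
    by (simp add: H_1)
  then have step: "weyl_act f (H - 1) (weyl_act f (weyl_poly f) 1) = svar * weyl_act f (weyl_poly f) 1"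
    unfolding weyl_act_svar by (simp only: weyl_act_simps(5))
  have "weyl_act f ((H - 1) ^ Suc j * weyl_poly f) 1
      = weyl_act f (H - 1) (weyl_act f ((H - 1) ^ j * weyl_poly f) 1)"
    by (simp only: power_Suc mult.assoc weyl_act_simps(5))
  also have "\<dots> = svar ^ j * (svar * weyl_act f (weyl_poly f) 1)"
    unfolding Suc weyl_act_svar_power step ..
  finally show ?case
    by (simp only: power_Suc2 mult.assoc)
qed simp

text \<open>
  With \<open>P = \<Sum>j P_j s^j\<close>, the operator is \<open>Q = \<Sum>j P_j (H - 1)^j\<close>.
\<close>

lemma weyls_act_eq_weyl_act:
  "\<exists>Q. weyls_act f (P * Poly_Mapping.single 0 (weyl_poly f)) 1 = weyl_act f (Q * weyl_poly f) 1"
proof -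
  let ?R = "P * Poly_Mapping.single 0 (weyl_poly f)"
  define Q where "Q = (\<Sum>j\<in>Poly_Mapping.keys ?R. Poly_Mapping.lookup P j * (H - 1) ^ j)"
  have "weyls_act f ?R 1 = (\<Sum>j\<in>Poly_Mapping.keys ?R.
      weyl_act f (Poly_Mapping.lookup P j * (H - 1) ^ j * weyl_poly f) 1)"
    unfolding weyls_act_def lookup_mult_single_0
    by (rule sum.cong[OF HOL.refl])
      (simp only: mult.assoc weyl_act_simps(5)[of f "Poly_Mapping.lookup P _"]
        weyl_act_shifted_power weyl_act_svar_power)
  then show ?thesis
    unfolding Q_def[symmetric] weyl_act_sum[symmetric] sum_distrib_right[symmetric] by blast
qed

text \<open>
  If \<open>(P f) f^s = b(s) f^s\<close>, then eliminating \<open>s\<close> on both sides gives \<open>Q f - b(H)\<close> in the annihilator,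
  hence in \<open>D_n (x_1, ..., x_n)\<close>. Modulo this ideal \<open>Q f\<close> is zero and \<open>b(H)\<close> is \<open>b(\<gamma>)\<close>, so the ideal
  contains the scalar \<open>b(\<gamma>)\<close>; being proper, it contains no other scalar than zero.
\<close>

lemma bernstein_ideal_root:
  assumes ann: "ann_fs f \<subseteq> var_ideal" and f: "weyl_poly f \<in> var_ideal"
    and b: "b \<in> bernstein_ideal f"
  shows "poly b \<gamma> = 0"
proof -
  obtain P where P: "weyls_act f (P * Poly_Mapping.single 0 (weyl_poly f)) 1 = smod_of_poly b"
    using b unfolding bernstein_ideal_def by blast
  obtain Q where Q: "weyl_act f (Q * weyl_poly f) 1 = smod_of_poly b"
    using weyls_act_eq_weyl_act[of P] P by metis
  obtain B where B: "weyl_act f B 1 = smod_of_poly b"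
    "B - weyl_poly (mconst (poly b \<gamma>)) \<in> var_ideal"
    using exists_operator_of_poly[of b] by blast
  have "weyl_act f (Q * weyl_poly f + - B) 1 = 0"
    unfolding weyl_act_simps(3,4) Q B(1) by simp
  then have "Q * weyl_poly f + - B \<in> var_ideal"
    using ann by (auto simp: ann_fs_def)
  then have "Q * weyl_poly f - (Q * weyl_poly f + - B) - (B - weyl_poly (mconst (poly b \<gamma>))) \<in> var_ideal"
    by (intro left_ideal_diff[OF left_ideal_diff B(2)] left_ideal_mult[OF f])
  moreover have "Q * weyl_poly f - (Q * weyl_poly f + - B) - (B - weyl_poly (mconst (poly b \<gamma>)))
      = weyl_poly (mconst (poly b \<gamma>))"
    by simp
  ultimately show ?thesis
    by (metis weyl_poly_mconst_in_var_ideal)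
qed

end

lemma euler_s_operator:
  fixes l :: "nat \<Rightarrow> complex^'n::{finite,linorder}"
  assumes d: "0 < d" and nz: "\<And>i. i < d \<Longrightarrow> l i \<noteq> 0" and f: "f = (\<Prod>i<d. lform (l i))"
  shows "s_operator f (weyl_poly (mconst (1 / of_nat d)) * euler) (- of_nat CARD('n) / of_nat d)"
proof
  let ?c = "weyl_poly (mconst (1 / of_nat d)) :: 'n weyl"
  have f0: "f \<noteq> 0"
    using nz by (auto simp: f lform_eq_0_iff)
  have E: "vf_apply mvar f = of_nat d * f"
    unfolding f by (rule vf_apply_mvar_prod_lform)
  have inv: "mconst (1 / of_nat d) * of_nat d = (1 :: 'n mpoly)"
    unfolding of_nat_mconst using d by (simp flip: mconst_mult)
  have "weyl_act f euler 1 = [:0, Fract (of_nat d * f) f:]"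
    unfolding euler_def weyl_act_vf_weyl_1[OF f0] E ..
  moreover have "Fract (mconst (1 / of_nat d)) 1 * Fract (of_nat d * f) f = 1"
    using f0 inv by (simp add: eq_fract One_fract_def flip: mult.assoc)
  ultimately show "weyl_act f (?c * euler) 1 = svar"
    by (simp add: fs_scale_def)
  have "?c * euler * weyl_poly f = ?c * weyl_poly f * euler + ?c * weyl_poly (of_nat d * f)"
    by (simp add: euler_def mult.assoc vf_weyl_mult_weyl_poly E ring_distribs)
  also have "?c * weyl_poly f = weyl_poly f * ?c"
    by (rule weyl_poly_mconst_central)
  also have "?c * weyl_poly (of_nat d * f) = weyl_poly f"
    by (simp add: inv flip: weyl_poly_mult mult.assoc)
  finally show "?c * euler * weyl_poly f = weyl_poly f * (?c * euler) + weyl_poly f"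
    by (simp add: mult.assoc)
  have "(of_nat CARD('n) :: 'n weyl) = weyl_poly (mconst (of_nat CARD('n)))"
    by (simp add: weyl_poly_of_nat flip: of_nat_mconst)
  then have "?c * of_nat CARD('n) = weyl_poly (mconst (of_nat CARD('n) / of_nat d))"
    by (simp flip: weyl_poly_mult mconst_mult)
  then have "?c * euler - weyl_poly (mconst (- of_nat CARD('n) / of_nat d))
      = ?c * (euler + of_nat CARD('n))"
    by (simp add: ring_distribs mconst_uminus weyl_poly_uminus)
  then show "?c * euler - weyl_poly (mconst (- of_nat CARD('n) / of_nat d)) \<in> var_ideal"
    using left_ideal_mult[OF euler_mod_var_ideal] by simp
qed


section \<open>Logarithmic derivations and the root \<open>- n/d\<close>\<close>

theorem theorem5p13:
  fixes L :: "nat \<Rightarrow> 'n::{finite,linorder} mpoly" and d :: nat and f :: "'n mpoly"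
  assumes "d \<ge> 1"
    and "\<And>i. i < d \<Longrightarrow> linear_form (L i)"
    and "f = (\<Prod>i<d. L i)"
    and "\<not> decomposable f"
  shows "Der_log0 f \<subseteq> left_ideal (weyl_poly ` mvar ` UNIV) \<and>
    (ann_fs f = left_ideal (Der_log0 f) \<longrightarrow>
      (\<forall>b. is_bernstein_sato f b \<longrightarrow> poly b (- of_nat CARD('n) / of_nat d) = 0))"
proof -
  have d: "0 < d"
    using assms(1) by simp
  have "\<exists>l. L i = lform l \<and> l \<noteq> 0" if "i < d" for i
    using linear_form_eq_lform[OF assms(2)[OF that]] by metis
  then obtain l where l: "\<And>i. i < d \<Longrightarrow> L i = lform (l i)" "\<And>i. i < d \<Longrightarrow> l i \<noteq> 0"
    by metis
  have f: "f = (\<Prod>i<d. lform (l i))"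
    unfolding assms(3) by (rule prod.cong) (simp_all add: l(1))
  have Der: "Der_log0 f \<subseteq> var_ideal"
  proof
    fix P assume "P \<in> Der_log0 f"
    then obtain a where a: "P = vf_weyl a" "vf_apply a f = 0"
      unfolding Der_log0_def by blast
    show "P \<in> var_ideal"
      unfolding a(1)
      using log_derivation_vanishes[OF d l(2) assms(4)[unfolded f] a(2)[unfolded f]]
      by (intro vf_weyl_in_var_ideal)
  qed
  have "poly b (- of_nat CARD('n) / of_nat d) = 0"
    if ann: "ann_fs f = left_ideal (Der_log0 f)" and b: "is_bernstein_sato f b" for b
  proof -
    interpret s_operator f "weyl_poly (mconst (1 / of_nat d)) * euler" "- of_nat CARD('n) / of_nat d"
      by (rule euler_s_operator[OF d l(2) f])
    have "weyl_poly (lform v) \<in> var_ideal" for v :: "((complex, 'n) vec)"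
      unfolding lform_def weyl_poly_sum weyl_poly_mult
      by (intro left_ideal_sum left_ideal_mult weyl_poly_mvar_in_ideal)
    moreover have "f = (\<Prod>i\<in>{..<d} - {0}. lform (l i)) * lform (l 0)"
      unfolding f using d by (subst prod.remove[of _ 0]) (auto simp: mult.commute)
    ultimately have "weyl_poly f \<in> var_ideal"
      by (metis left_ideal_mult weyl_poly_mult)
    moreover have "b \<in> bernstein_ideal f"
      using b unfolding is_bernstein_sato_def by (metis (mono_tags, lifting) mem_Collect_eq mult.right_neutral)
    moreover have "ann_fs f \<subseteq> var_ideal"
      unfolding ann using Der by (rule left_ideal_subset)
    ultimately show ?thesis
      by (intro bernstein_ideal_root)
  qed
  with Der show ?thesis
    by blast
qed

end
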